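(* Let $f\colon\mathbb{P}^2_{\mathbb{Q}}\to\mathbb{P}^2_{\mathbb{Q}}$ be given by $$f(x:y:z)=(x^2+yz:\ x^2+y^2+yz:\ z^2).$$ For $p\le\infty$ (i.e. $p$ a prime number or $p=\infty$), let $f_{\mathbb{Q}_p}:=f\times_{\mathbb{Q}}\mathbb{Q}_p$ be the base change. Then for all $p\le\infty$ and all $n\ge 1$ there exist $a_{n,p},b_{n,p}\in\mathbb{P}^2(\mathbb{Q}_p)$ such that $$f_{\mathbb{Q}_p}^{n}(a_{n,p})=f_{\mathbb{Q}_p}^{n}(b_{n,p})\quad\text{and}\quad f_{\mathbb{Q}_p}^{n-1}(a_{n,p})\ne f_{\mathbb{Q}_p}^{n-1}(b_{n,p}).$$
   Context: $\mathbb{Q}_\infty=\mathbb{R}$. $f^{n}$ denotes the $n$-fold composite of $f$ (with $f^0=\mathrm{id}$). *)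

theory Defs
  imports
    "HOL-Algebra.QuotRing"
    "HOL-Algebra.Algebraic_Closure_Type"
    "HOL-Computational_Algebra.Primes"
begin

text \<open>Normalised so that $|p|_p = 1/p$; \<^const>\<open>quotient_of\<close> yields the reduced fraction,
  so at most one of the two multiplicities is nonzero.\<close>

definition padic_abs :: "nat \<Rightarrow> rat \<Rightarrow> real" where
  "padic_abs p q =
     (if q = 0 then 0
      else real p powi (int (multiplicity (int p) (snd (quotient_of q)))
                        - int (multiplicity (int p) (fst (quotient_of q)))))"

definition padic_Cauchy :: "nat \<Rightarrow> (nat \<Rightarrow> rat) set" where
  "padic_Cauchy p =
     {S. \<forall>e>0. \<exists>N. \<forall>m\<ge>N. \<forall>n\<ge>N. padic_abs p (S m - S n) < e}"

definition padic_null :: "nat \<Rightarrow> (nat \<Rightarrow> rat) set" where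
  "padic_null p = {S. (\<lambda>n. padic_abs p (S n)) \<longlonglongrightarrow> 0}"

definition padic_Cauchy_ring :: "nat \<Rightarrow> (nat \<Rightarrow> rat) ring" where
  "padic_Cauchy_ring p =
     \<lparr>carrier = padic_Cauchy p,
      monoid.mult = (\<lambda>S T n. S n * T n), one = (\<lambda>_. 1),
      zero = (\<lambda>_. 0), add = (\<lambda>S T n. S n + T n)\<rparr>"

text \<open>The completion of the rationals with respect to \<^const>\<open>padic_abs\<close>:
  Cauchy sequences modulo null sequences.\<close>

definition Qp :: "nat \<Rightarrow> (nat \<Rightarrow> rat) set ring" where
  "Qp p = padic_Cauchy_ring p Quot padic_null p"

context
  fixes p :: nat
  assumes p: "Factorial_Ring.prime p"
begin

lemma padic_abs_nonneg [simp]: "padic_abs p x \<ge> 0"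
  by (simp add: padic_abs_def)

lemma padic_abs_0 [simp]: "padic_abs p 0 = 0"
  by (simp add: padic_abs_def)

lemma padic_abs_eq_0_iff [simp]: "padic_abs p x = 0 \<longleftrightarrow> x = 0"
  using prime_gt_0_nat[OF p] by (simp add: padic_abs_def)

lemma prime_p_int: "Factorial_Ring.prime_elem (int p)"
  using p by auto

lemma padic_abs_fract:
  assumes "a \<noteq> 0" "b \<noteq> 0"
  shows "padic_abs p (of_int a / of_int b) =
           real p powi (int (multiplicity (int p) b) - int (multiplicity (int p) a))"
proof -
  define x where "x = (of_int a / of_int b :: rat)"
  obtain c d where cd: "quotient_of x = (c, d)"
    by force
  have d: "d > 0" and x: "x = of_int c / of_int d"
    using quotient_of_denom_pos[OF cd] quotient_of_div[OF cd] by auto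
  have x0: "x \<noteq> 0"
    using assms by (simp add: x_def)
  hence c: "c \<noteq> 0"
    using x by auto
  have "of_int (a * d) = (of_int (c * b) :: rat)"
    using x assms d unfolding x_def by (simp add: field_simps)
  hence eq: "a * d = c * b"
    by (simp only: of_int_eq_iff)
  have "multiplicity (int p) a + multiplicity (int p) d
          = multiplicity (int p) c + multiplicity (int p) b"
    using arg_cong[OF eq, of "multiplicity (int p)"] prime_p_int assms c d
    by (simp add: prime_elem_multiplicity_mult_distrib)
  hence "int (multiplicity (int p) d) - int (multiplicity (int p) c)
           = int (multiplicity (int p) b) - int (multiplicity (int p) a)"
    by linarith
  thus ?thesis
    using x0 cd by (simp add: padic_abs_def flip: x_def)
qed

lemma rat_as_fract: obtains a b where "b \<noteq> 0" "(x :: rat) = of_int a / of_int b"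
  by (metis quotient_of_denom_pos quotient_of_div surj_pair less_irrefl)

lemma padic_abs_mult: "padic_abs p (x * y) = padic_abs p x * padic_abs p y"
proof (cases "x = 0 \<or> y = 0")
  case False
  obtain a b where ab: "b \<noteq> 0" "x = of_int a / of_int b" by (rule rat_as_fract)
  obtain c d where cd: "d \<noteq> 0" "y = of_int c / of_int d" by (rule rat_as_fract)
  have nz: "a \<noteq> 0" "c \<noteq> 0" using False ab cd by auto
  have xy: "x * y = of_int (a * c) / of_int (b * d)" using ab cd by simp
  have p0: "real p \<noteq> 0" using prime_gt_0_nat[OF p] by simp
  have "padic_abs p (of_int (a * c) / of_int (b * d)) =
          padic_abs p (of_int a / of_int b) * padic_abs p (of_int c / of_int d)"
    using nz ab(1) cd(1) prime_p_int p0
    by (simp add: padic_abs_fract prime_elem_multiplicity_mult_distrib algebra_simps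
             del: of_int_mult flip: power_int_add)
  thus ?thesis
    by (simp only: xy flip: ab(2) cd(2))
qed auto

lemma padic_abs_1 [simp]: "padic_abs p 1 = 1"
  using padic_abs_fract[of 1 1] by simp

lemma padic_abs_uminus [simp]: "padic_abs p (- x) = padic_abs p x"
proof -
  have "padic_abs p (-1) = 1"
    using padic_abs_fract[of "-1" 1] by simp
  thus ?thesis
    using padic_abs_mult[of "-1" x] by simp
qed

lemma padic_abs_add: "padic_abs p (x + y) \<le> max (padic_abs p x) (padic_abs p y)"
proof (cases "x = 0 \<or> y = 0 \<or> x + y = 0")
  case False
  obtain a b where ab: "b \<noteq> 0" "x = of_int a / of_int b" by (rule rat_as_fract)
  obtain c d where cd: "d \<noteq> 0" "y = of_int c / of_int d" by (rule rat_as_fract)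
  define A C D where "A = a * d" "C = c * b" "D = b * d"
  have D: "D \<noteq> 0" and x: "x = of_int A / of_int D" and y: "y = of_int C / of_int D"
    using ab cd by (auto simp: A_C_D_def)
  have xy: "x + y = of_int (A + C) / of_int D"
    using x y by (simp add: add_divide_distrib)
  have nz: "A \<noteq> 0" "C \<noteq> 0" "A + C \<noteq> 0"
    using False x y xy by auto
  have p1: "real p \<ge> 1" using prime_gt_0_nat[OF p] by simp
  have npu: "\<not> is_unit (int p)"
    by (rule prime_elem_not_unit[OF prime_p_int])
  have "min (multiplicity (int p) A) (multiplicity (int p) C) \<le> multiplicity (int p) (A + C)"
    using nz npu by (intro multiplicity_geI dvd_add) (auto simp: multiplicity_dvd')
  hence "multiplicity (int p) A \<le> multiplicity (int p) (A + C)
           \<or> multiplicity (int p) C \<le> multiplicity (int p) (A + C)"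
    by linarith
  hence "padic_abs p (of_int (A + C) / of_int D)
           \<le> max (padic_abs p (of_int A / of_int D)) (padic_abs p (of_int C / of_int D))"
    using nz D
    by (auto simp: padic_abs_fract le_max_iff_disj simp del: of_int_add
             intro!: power_int_increasing[OF _ p1])
  thus ?thesis
    by (simp only: flip: x y xy)
qed (auto simp: max_def)

lemma padic_abs_diff: "padic_abs p (x - y) \<le> max (padic_abs p x) (padic_abs p y)"
  using padic_abs_add[of x "- y"] by simp

lemma padic_abs_inverse: "padic_abs p (inverse x) = inverse (padic_abs p x)"
proof (cases "x = 0")
  case False
  thus ?thesis
    using padic_abs_mult[of x "inverse x"] by (simp add: field_simps)
qed auto

lemma padic_CauchyI:
  assumes "\<And>e. e > 0 \<Longrightarrow> \<exists>N. \<forall>m\<ge>N. \<forall>n\<ge>N. padic_abs p (S m - S n) < e"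
  shows "S \<in> padic_Cauchy p"
  using assms by (auto simp: padic_Cauchy_def)

lemma padic_CauchyD:
  assumes "S \<in> padic_Cauchy p" "e > 0"
  obtains N where "\<And>m n. m \<ge> N \<Longrightarrow> n \<ge> N \<Longrightarrow> padic_abs p (S m - S n) < e"
  using assms unfolding padic_Cauchy_def by blast

lemma padic_Cauchy_bounded:
  assumes "S \<in> padic_Cauchy p"
  obtains B where "B > 0" "\<And>n. padic_abs p (S n) \<le> B"
proof -
  obtain N where N: "\<And>m n. m \<ge> N \<Longrightarrow> n \<ge> N \<Longrightarrow> padic_abs p (S m - S n) < 1"
    using padic_CauchyD[OF assms zero_less_one] by blast
  define B where "B = 1 + (\<Sum>k\<le>N. padic_abs p (S k))"
  have le: "padic_abs p (S n) \<le> (\<Sum>k\<le>N. padic_abs p (S k))" if "n \<le> N" for n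
    using that by (intro member_le_sum) auto
  have "padic_abs p (S n) \<le> B" for n
  proof (cases "n \<le> N")
    case True
    thus ?thesis using le[of n] by (simp add: B_def)
  next
    case False
    have "padic_abs p (S n) \<le> max (padic_abs p (S n - S N)) (padic_abs p (S N))"
      using padic_abs_add[of "S n - S N" "S N"] by simp
    also have "\<dots> \<le> B"
      using N[of n N] False le[of N] sum_nonneg[of "{..N}" "\<lambda>k. padic_abs p (S k)"]
      by (simp add: B_def)
    finally show ?thesis .
  qed
  moreover have "B > 0"
    using sum_nonneg[of "{..N}" "\<lambda>k. padic_abs p (S k)"] by (simp add: B_def)
  ultimately show ?thesis using that by blast
qed

lemma padic_Cauchy_const [simp]: "(\<lambda>_. c) \<in> padic_Cauchy p"
  by (rule padic_CauchyI) auto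

lemma padic_Cauchy_add:
  assumes "S \<in> padic_Cauchy p" "T \<in> padic_Cauchy p"
  shows "(\<lambda>n. S n + T n) \<in> padic_Cauchy p"
proof (rule padic_CauchyI)
  fix e :: real assume e: "e > 0"
  obtain M where M: "\<And>m n. m \<ge> M \<Longrightarrow> n \<ge> M \<Longrightarrow> padic_abs p (S m - S n) < e"
    using padic_CauchyD[OF assms(1) e] by blast
  obtain N where N: "\<And>m n. m \<ge> N \<Longrightarrow> n \<ge> N \<Longrightarrow> padic_abs p (T m - T n) < e"
    using padic_CauchyD[OF assms(2) e] by blast
  have "padic_abs p (S m + T m - (S n + T n)) < e" if "m \<ge> max M N" "n \<ge> max M N" for m n
    using padic_abs_add[of "S m - S n" "T m - T n"] M[of m n] N[of m n] that
    by (simp add: algebra_simps)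
  thus "\<exists>N. \<forall>m\<ge>N. \<forall>n\<ge>N. padic_abs p (S m + T m - (S n + T n)) < e" by blast
qed

lemma padic_Cauchy_mult:
  assumes "S \<in> padic_Cauchy p" "T \<in> padic_Cauchy p"
  shows "(\<lambda>n. S n * T n) \<in> padic_Cauchy p"
proof (rule padic_CauchyI)
  fix e :: real assume e: "e > 0"
  obtain A where A: "A > 0" "\<And>n. padic_abs p (S n) \<le> A"
    using padic_Cauchy_bounded[OF assms(1)] by blast
  obtain B where B: "B > 0" "\<And>n. padic_abs p (T n) \<le> B"
    using padic_Cauchy_bounded[OF assms(2)] by blast
  obtain M where M: "\<And>m n. m \<ge> M \<Longrightarrow> n \<ge> M \<Longrightarrow> padic_abs p (S m - S n) < e / B"
    using padic_CauchyD[OF assms(1), of "e / B"] e B by auto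
  obtain N where N: "\<And>m n. m \<ge> N \<Longrightarrow> n \<ge> N \<Longrightarrow> padic_abs p (T m - T n) < e / A"
    using padic_CauchyD[OF assms(2), of "e / A"] e A by auto
  have "padic_abs p (S m * T m - S n * T n) < e" if "m \<ge> max M N" "n \<ge> max M N" for m n
  proof -
    have "padic_abs p ((S m - S n) * T m) < e"
    proof -
      have "padic_abs p (S m - S n) * padic_abs p (T m) \<le> padic_abs p (S m - S n) * B"
        by (intro mult_left_mono B) auto
      also have "\<dots> < e / B * B"
        using M[of m n] that B by (intro mult_strict_right_mono) auto
      finally show ?thesis using B by (simp add: padic_abs_mult)
    qed
    moreover have "padic_abs p (S n * (T m - T n)) < e"
    proof -
      have "padic_abs p (S n) * padic_abs p (T m - T n) \<le> A * padic_abs p (T m - T n)"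
        by (intro mult_right_mono A) auto
      also have "\<dots> < A * (e / A)"
        using N[of m n] that A by (intro mult_strict_left_mono) auto
      finally show ?thesis using A by (simp add: padic_abs_mult)
    qed
    ultimately show ?thesis
      using padic_abs_add[of "(S m - S n) * T m" "S n * (T m - T n)"]
      by (simp add: algebra_simps)
  qed
  thus "\<exists>N. \<forall>m\<ge>N. \<forall>n\<ge>N. padic_abs p (S m * T m - S n * T n) < e" by blast
qed

lemma padic_Cauchy_uminus:
  "S \<in> padic_Cauchy p \<Longrightarrow> (\<lambda>n. - S n) \<in> padic_Cauchy p"
  using padic_Cauchy_mult[of "\<lambda>_. -1" S] by simp

lemma padic_nullI:
  assumes "\<And>e. e > 0 \<Longrightarrow> \<exists>N. \<forall>n\<ge>N. padic_abs p (S n) < e"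
  shows "S \<in> padic_null p"
  using assms by (auto simp: padic_null_def LIMSEQ_iff)

lemma padic_nullD:
  assumes "S \<in> padic_null p" "e > 0"
  obtains N where "\<And>n. n \<ge> N \<Longrightarrow> padic_abs p (S n) < e"
  using assms by (auto simp: padic_null_def LIMSEQ_iff)

lemma padic_null_imp_Cauchy:
  assumes "S \<in> padic_null p"
  shows "S \<in> padic_Cauchy p"
proof (rule padic_CauchyI)
  fix e :: real assume e: "e > 0"
  obtain N where N: "\<And>n. n \<ge> N \<Longrightarrow> padic_abs p (S n) < e"
    using padic_nullD[OF assms e] by blast
  have "padic_abs p (S m - S n) < e" if "m \<ge> N" "n \<ge> N" for m n
    using padic_abs_diff[of "S m" "S n"] N[of m] N[of n] that by simp
  thus "\<exists>N. \<forall>m\<ge>N. \<forall>n\<ge>N. padic_abs p (S m - S n) < e" by blast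
qed

lemma padic_null_add:
  assumes "S \<in> padic_null p" "T \<in> padic_null p"
  shows "(\<lambda>n. S n + T n) \<in> padic_null p"
proof (rule padic_nullI)
  fix e :: real assume e: "e > 0"
  obtain M where M: "\<And>n. n \<ge> M \<Longrightarrow> padic_abs p (S n) < e"
    using padic_nullD[OF assms(1) e] by blast
  obtain N where N: "\<And>n. n \<ge> N \<Longrightarrow> padic_abs p (T n) < e"
    using padic_nullD[OF assms(2) e] by blast
  have "padic_abs p (S n + T n) < e" if "n \<ge> max M N" for n
    using padic_abs_add[of "S n" "T n"] M[of n] N[of n] that by simp
  thus "\<exists>N. \<forall>n\<ge>N. padic_abs p (S n + T n) < e" by blast
qed

lemma padic_null_mult:
  assumes "S \<in> padic_null p" "T \<in> padic_Cauchy p"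
  shows "(\<lambda>n. T n * S n) \<in> padic_null p"
proof (rule padic_nullI)
  fix e :: real assume e: "e > 0"
  obtain B where B: "B > 0" "\<And>n. padic_abs p (T n) \<le> B"
    using padic_Cauchy_bounded[OF assms(2)] by blast
  obtain N where N: "\<And>n. n \<ge> N \<Longrightarrow> padic_abs p (S n) < e / B"
    using padic_nullD[OF assms(1), of "e / B"] e B by auto
  have "padic_abs p (T n * S n) < e" if "n \<ge> N" for n
  proof -
    have "padic_abs p (T n) * padic_abs p (S n) \<le> B * padic_abs p (S n)"
      by (intro mult_right_mono B) auto
    also have "\<dots> < B * (e / B)"
      using N[of n] that B by (intro mult_strict_left_mono) auto
    finally show ?thesis using B by (simp add: padic_abs_mult)
  qed
  thus "\<exists>N. \<forall>n\<ge>N. padic_abs p (T n * S n) < e" by blast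
qed

lemma padic_null_0 [simp]: "(\<lambda>_. 0) \<in> padic_null p"
  by (simp add: padic_null_def)

lemma padic_null_uminus: "S \<in> padic_null p \<Longrightarrow> (\<lambda>n. - S n) \<in> padic_null p"
  by (simp add: padic_null_def)

lemma cring_padic_Cauchy_ring: "cring (padic_Cauchy_ring p)"
proof (rule cringI)
  show "abelian_group (padic_Cauchy_ring p)"
  proof (rule abelian_groupI)
    fix S assume "S \<in> carrier (padic_Cauchy_ring p)"
    thus "\<exists>T\<in>carrier (padic_Cauchy_ring p).
            T \<oplus>\<^bsub>padic_Cauchy_ring p\<^esub> S = \<zero>\<^bsub>padic_Cauchy_ring p\<^esub>"
      by (intro bexI[of _ "\<lambda>n. - S n"]) (auto simp: padic_Cauchy_ring_def padic_Cauchy_uminus)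
  qed (auto simp: padic_Cauchy_ring_def padic_Cauchy_add algebra_simps)
  show "comm_monoid (padic_Cauchy_ring p)"
    by (rule comm_monoidI)
      (auto simp: padic_Cauchy_ring_def padic_Cauchy_mult algebra_simps)
qed (auto simp: padic_Cauchy_ring_def algebra_simps)

lemma padic_Cauchy_ring_uminus:
  assumes "S \<in> padic_Cauchy p"
  shows "\<ominus>\<^bsub>padic_Cauchy_ring p\<^esub> S = (\<lambda>n. - S n)"
proof -
  interpret cring "padic_Cauchy_ring p" by (rule cring_padic_Cauchy_ring)
  show ?thesis
    by (rule minus_equality)
      (use assms padic_Cauchy_uminus in \<open>auto simp: padic_Cauchy_ring_def\<close>)
qed

lemma ideal_padic_null: "ideal (padic_null p) (padic_Cauchy_ring p)"
proof -
  interpret cring "padic_Cauchy_ring p" by (rule cring_padic_Cauchy_ring)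
  show ?thesis
  proof (rule idealI)
    show "subgroup (padic_null p) (add_monoid (padic_Cauchy_ring p))"
    proof (rule add.subgroupI)
      show "padic_null p \<noteq> {}"
        using padic_null_0 by blast
      fix S assume S: "S \<in> padic_null p"
      thus "\<ominus>\<^bsub>padic_Cauchy_ring p\<^esub> S \<in> padic_null p"
        by (simp add: padic_Cauchy_ring_uminus padic_null_imp_Cauchy padic_null_uminus)
    qed (auto simp: padic_Cauchy_ring_def padic_null_imp_Cauchy padic_null_add)
  next
    fix S T assume "S \<in> padic_null p" "T \<in> carrier (padic_Cauchy_ring p)"
    hence *: "(\<lambda>n. T n * S n) \<in> padic_null p"
      by (simp add: padic_Cauchy_ring_def padic_null_mult)
    show "T \<otimes>\<^bsub>padic_Cauchy_ring p\<^esub> S \<in> padic_null p"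
      using * by (simp add: padic_Cauchy_ring_def)
    show "S \<otimes>\<^bsub>padic_Cauchy_ring p\<^esub> T \<in> padic_null p"
      using * by (simp add: padic_Cauchy_ring_def mult.commute)
  qed (rule ring_axioms)
qed

lemma padic_Cauchy_inverse:
  assumes S: "S \<in> padic_Cauchy p" and nS: "S \<notin> padic_null p"
  shows "(\<lambda>n. inverse (S n)) \<in> padic_Cauchy p"
    and "(\<lambda>n. S n * inverse (S n) - 1) \<in> padic_null p"
proof -
  obtain e where e: "e > 0" "\<And>N. \<exists>n\<ge>N. padic_abs p (S n) \<ge> e"
    using nS padic_nullI[of S] by (meson not_le)
  obtain M where M: "\<And>m n. m \<ge> M \<Longrightarrow> n \<ge> M \<Longrightarrow> padic_abs p (S m - S n) < e"
    using padic_CauchyD[OF S e(1)] by blast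
  have ge: "padic_abs p (S n) \<ge> e" if "n \<ge> M" for n
  proof (rule ccontr)
    assume lt: "\<not> padic_abs p (S n) \<ge> e"
    obtain k where k: "k \<ge> M" "padic_abs p (S k) \<ge> e" using e(2)[of M] by blast
    have "padic_abs p (S k) \<le> max (padic_abs p (S k - S n)) (padic_abs p (S n))"
      using padic_abs_add[of "S k - S n" "S n"] by simp
    thus False using M[of k n] k that lt by linarith
  qed
  have nz: "S n \<noteq> 0" if "n \<ge> M" for n
    using ge[OF that] e(1) by auto
  show "(\<lambda>n. S n * inverse (S n) - 1) \<in> padic_null p"
    by (rule padic_nullI, rule exI[of _ M]) (simp add: nz)
  show "(\<lambda>n. inverse (S n)) \<in> padic_Cauchy p"
  proof (rule padic_CauchyI)
    fix d :: real assume d: "d > 0"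
    obtain N where N: "\<And>m n. m \<ge> N \<Longrightarrow> n \<ge> N \<Longrightarrow> padic_abs p (S m - S n) < d * (e * e)"
      using padic_CauchyD[OF S, of "d * (e * e)"] d e by auto
    have "padic_abs p (inverse (S m) - inverse (S n)) < d" if "m \<ge> max M N" "n \<ge> max M N" for m n
    proof -
      have "inverse (S m) - inverse (S n) = (S n - S m) * inverse (S m * S n)"
        using nz[of m] nz[of n] that by (simp add: field_simps)
      hence "padic_abs p (inverse (S m) - inverse (S n)) =
               padic_abs p (S n - S m) / (padic_abs p (S m) * padic_abs p (S n))"
        by (simp add: padic_abs_mult padic_abs_inverse divide_inverse)
      also have "\<dots> \<le> padic_abs p (S n - S m) / (e * e)"
        using ge[of m] ge[of n] that e(1)
        by (intro divide_left_mono mult_mono mult_pos_pos) auto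
      also have "\<dots> < d"
        using N[of n m] that e(1) by (simp add: field_simps)
      finally show ?thesis .
    qed
    thus "\<exists>N. \<forall>m\<ge>N. \<forall>n\<ge>N. padic_abs p (inverse (S m) - inverse (S n)) < d" by blast
  qed
qed

lemma field_Qp: "field (Qp p)"
proof -
  interpret C: cring "padic_Cauchy_ring p" by (rule cring_padic_Cauchy_ring)
  interpret I: ideal "padic_null p" "padic_Cauchy_ring p" by (rule ideal_padic_null)
  have "maximalideal (padic_null p) (padic_Cauchy_ring p)"
  proof (rule maximalidealI[OF ideal_padic_null])
    have "(\<lambda>_. 1) \<notin> padic_null p"
      by (auto simp: padic_null_def LIMSEQ_const_iff)
    moreover have "(\<lambda>_. 1) \<in> carrier (padic_Cauchy_ring p)"
      by (simp add: padic_Cauchy_ring_def)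
    ultimately show "carrier (padic_Cauchy_ring p) \<noteq> padic_null p"
      by metis
  next
    fix J assume J: "ideal J (padic_Cauchy_ring p)" and sub: "padic_null p \<subseteq> J"
      and Jc: "J \<subseteq> carrier (padic_Cauchy_ring p)"
    interpret J: ideal J "padic_Cauchy_ring p" by (rule J)
    show "J = padic_null p \<or> J = carrier (padic_Cauchy_ring p)"
    proof (cases "J = padic_null p")
      case False
      then obtain S where SJ: "S \<in> J" and nS: "S \<notin> padic_null p"
        using sub by blast
      have S: "S \<in> padic_Cauchy p"
        using SJ Jc by (auto simp: padic_Cauchy_ring_def)
      let ?T = "\<lambda>n. inverse (S n)"
      have "(\<lambda>n. S n * ?T n) \<in> J"
        using J.I_r_closed[OF SJ, of ?T] padic_Cauchy_inverse(1)[OF S nS]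
        by (simp add: padic_Cauchy_ring_def)
      moreover have "(\<lambda>n. - (S n * ?T n - 1)) \<in> J"
        using padic_null_uminus[OF padic_Cauchy_inverse(2)[OF S nS]] sub by blast
      ultimately have "(\<lambda>n. S n * ?T n + - (S n * ?T n - 1)) \<in> J"
        using J.a_closed[of "\<lambda>n. S n * ?T n" "\<lambda>n. - (S n * ?T n - 1)"]
        by (simp add: padic_Cauchy_ring_def)
      hence "\<one>\<^bsub>padic_Cauchy_ring p\<^esub> \<in> J"
        by (simp add: padic_Cauchy_ring_def)
      hence "J = carrier (padic_Cauchy_ring p)"
        by (rule J.one_imp_carrier)
      thus ?thesis ..
    qed simp
  qed
  thus ?thesis
    unfolding Qp_def using C.is_cring by (rule maximalideal.quotient_is_field)
qed

end

definition nonzero_triples :: "('a, 'b) ring_scheme \<Rightarrow> ('a \<times> 'a \<times> 'a) set" where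
  "nonzero_triples K =
     carrier K \<times> carrier K \<times> carrier K - {(\<zero>\<^bsub>K\<^esub>, \<zero>\<^bsub>K\<^esub>, \<zero>\<^bsub>K\<^esub>)}"

definition proj_rel ::
    "('a, 'b) ring_scheme \<Rightarrow> (('a \<times> 'a \<times> 'a) \<times> ('a \<times> 'a \<times> 'a)) set" where
  "proj_rel K =
     {((x, y, z), (x', y', z')).
        (x, y, z) \<in> nonzero_triples K \<and> (x', y', z') \<in> nonzero_triples K \<and>
        (\<exists>c \<in> carrier K - {\<zero>\<^bsub>K\<^esub>}.
           x' = c \<otimes>\<^bsub>K\<^esub> x \<and> y' = c \<otimes>\<^bsub>K\<^esub> y \<and> z' = c \<otimes>\<^bsub>K\<^esub> z)}"

definition proj_plane :: "('a, 'b) ring_scheme \<Rightarrow> ('a \<times> 'a \<times> 'a) set set" where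
  "proj_plane K = nonzero_triples K // proj_rel K"

fun f_triple :: "('a, 'b) ring_scheme \<Rightarrow> 'a \<times> 'a \<times> 'a \<Rightarrow> 'a \<times> 'a \<times> 'a" where
  "f_triple K (x, y, z) =
     (x [^]\<^bsub>K\<^esub> (2::nat) \<oplus>\<^bsub>K\<^esub> y \<otimes>\<^bsub>K\<^esub> z,
      x [^]\<^bsub>K\<^esub> (2::nat) \<oplus>\<^bsub>K\<^esub> y [^]\<^bsub>K\<^esub> (2::nat) \<oplus>\<^bsub>K\<^esub> y \<otimes>\<^bsub>K\<^esub> z,
      z [^]\<^bsub>K\<^esub> (2::nat))"

text \<open>The ring structure on the reals coming from the type class instance.\<close>

abbreviation real_field :: "real ring" where
  "real_field \<equiv> ring_of_type_algebra"

text \<open>The map induced by $f$ on $K$-rational points, for an extension $K$ of the rationals.  Since \<open>f_triple K\<close> respects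
  \<^const>\<open>proj_rel\<close>, the union below is a union of equal classes.\<close>

definition f_map :: "('a, 'b) ring_scheme \<Rightarrow> ('a \<times> 'a \<times> 'a) set \<Rightarrow> ('a \<times> 'a \<times> 'a) set" where
  "f_map K P = (\<Union>v\<in>P. proj_rel K `` {f_triple K v})"

context field
begin

lemma equiv_proj_rel: "equiv (nonzero_triples R) (proj_rel R)"
proof (rule equivI)
  show "proj_rel R \<subseteq> nonzero_triples R \<times> nonzero_triples R"
    by (auto simp: proj_rel_def)
  show "refl_on (nonzero_triples R) (proj_rel R)"
    by (rule refl_onI) (auto simp: proj_rel_def nonzero_triples_def intro!: bexI[of _ \<one>])
  show "sym (proj_rel R)"
  proof (rule symI)
    fix u v assume "(u, v) \<in> proj_rel R"
    then obtain x y z c where c: "c \<in> carrier R - {\<zero>}" "u = (x, y, z)"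
      "v = (c \<otimes> x, c \<otimes> y, c \<otimes> z)" "u \<in> nonzero_triples R" "v \<in> nonzero_triples R"
      by (auto simp: proj_rel_def)
    hence "inv c \<in> carrier R - {\<zero>}" "inv c \<otimes> c = \<one>" "x \<in> carrier R" "y \<in> carrier R" "z \<in> carrier R"
      using field_Units by (auto simp: nonzero_triples_def)
    thus "(v, u) \<in> proj_rel R"
      using c by (auto simp: proj_rel_def simp flip: m_assoc intro!: bexI[of _ "inv c"])
  qed
  show "trans (proj_rel R)"
  proof (rule transI)
    fix u v w assume uv: "(u, v) \<in> proj_rel R" and vw: "(v, w) \<in> proj_rel R"
    obtain x y z c where 1: "c \<in> carrier R - {\<zero>}" "u = (x, y, z)"
      "v = (c \<otimes> x, c \<otimes> y, c \<otimes> z)" "u \<in> nonzero_triples R"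
      using uv by (auto simp: proj_rel_def)
    obtain d where 2: "d \<in> carrier R - {\<zero>}" "w \<in> nonzero_triples R"
      "w = (d \<otimes> (c \<otimes> x), d \<otimes> (c \<otimes> y), d \<otimes> (c \<otimes> z))"
      using vw 1 by (auto simp: proj_rel_def)
    note c = 1 2
    thus "(u, w) \<in> proj_rel R"
      by (auto simp: proj_rel_def nonzero_triples_def m_assoc integral_iff
               intro!: bexI[of _ "d \<otimes> c"])
  qed
qed

lemma f_triple_nonzero:
  assumes "v \<in> nonzero_triples R"
  shows "f_triple R v \<in> nonzero_triples R"
proof -
  obtain x y z where v: "v = (x, y, z)" "x \<in> carrier R" "y \<in> carrier R" "z \<in> carrier R"
    using assms by (auto simp: nonzero_triples_def)
  have False if "f_triple R v = (\<zero>, \<zero>, \<zero>)"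
    using that assms v by (auto simp: nonzero_triples_def numeral_2_eq_2 integral_iff)
  thus ?thesis
    using v by (auto simp: nonzero_triples_def)
qed

lemma f_triple_congruent: "(\<lambda>v. proj_rel R `` {f_triple R v}) respects proj_rel R"
proof (rule congruentI)
  fix u v assume uv: "(u, v) \<in> proj_rel R"
  then obtain x y z c where c: "c \<in> carrier R - {\<zero>}" "u = (x, y, z)"
    "v = (c \<otimes> x, c \<otimes> y, c \<otimes> z)" "u \<in> nonzero_triples R" "v \<in> nonzero_triples R"
    by (auto simp: proj_rel_def)
  have xyz: "x \<in> carrier R" "y \<in> carrier R" "z \<in> carrier R"
    using c by (auto simp: nonzero_triples_def)
  have "c [^] (2::nat) \<in> carrier R - {\<zero>}"
    using c by (auto simp: numeral_2_eq_2 integral_iff)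
  moreover have "f_triple R v =
    (c [^] (2::nat) \<otimes> (x [^] (2::nat) \<oplus> y \<otimes> z),
     c [^] (2::nat) \<otimes> (x [^] (2::nat) \<oplus> y [^] (2::nat) \<oplus> y \<otimes> z),
     c [^] (2::nat) \<otimes> z [^] (2::nat))"
    using c xyz by (auto simp: numeral_2_eq_2 r_distr m_ac)
  ultimately have "(f_triple R u, f_triple R v) \<in> proj_rel R"
    using f_triple_nonzero[of u] f_triple_nonzero[of v] c by (auto simp: proj_rel_def)
  thus "proj_rel R `` {f_triple R u} = proj_rel R `` {f_triple R v}"
    by (rule equiv_class_eq[OF equiv_proj_rel])
qed

lemma f_map_class:
  assumes "v \<in> nonzero_triples R"
  shows "f_map R (proj_rel R `` {v}) = proj_rel R `` {f_triple R v}"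
  unfolding f_map_def using UN_equiv_class[OF equiv_proj_rel f_triple_congruent assms] .

lemma f_map_closed: "P \<in> proj_plane R \<Longrightarrow> f_map R P \<in> proj_plane R"
  unfolding proj_plane_def
  by (elim quotientE) (auto simp: f_map_class intro!: quotientI f_triple_nonzero)

end

end

theory Submission
  imports Defs
begin

text \<open>In the chart $z = 1$ the map is $(x, y) \<mapsto> (x^2 + y, x^2 + y + y^2)$, so a preimage of $(u, v)$ is
  found by taking a square root $y$ of $v - u$ and then a square root $x$ of $u - y$. The origin is
  fixed, and near it the diagonal is nearly fixed: $f^m(t, t) = (t(1 + o(1)), t(1 + o(1)))$ as $t \<to> 0$.
  Reflecting this point to $(-u, v)$ does not change its image under $f$, so it suffices that
  $(-u, v)$ is in the image of $f^m$ as well. Pulling $(-u, v)$ back $m$ times requires square roots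
  of elements of the form monomial times $1 + o(1)$, and for $t = a^4/2$ with $a$ a suitable
  iterate of $b \<mapsto> -b^4$ all these monomials are squares. This only uses that numbers
  close to $1$ have square roots close to $1$, which holds in the reals and in every $p$-adic field.\<close>

section \<open>Fields with an absolute value and square roots near one\<close>

text \<open>Common ground of the reals and the p-adic fields: \<open>nrm_add\<close> is the ordinary
  triangle inequality, which the ultrametric one implies, and \<open>sqrt_near_one\<close> stands in
  for completeness.\<close>

locale abs_field = field R for R (structure) +
  fixes nrm :: "'a \<Rightarrow> real"
  assumes nrm_nonneg: "x \<in> carrier R \<Longrightarrow> 0 \<le> nrm x"
    and nrm_one: "nrm \<one> = 1"
    and nrm_mult: "x \<in> carrier R \<Longrightarrow> y \<in> carrier R \<Longrightarrow> nrm (x \<otimes> y) = nrm x * nrm y"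
    and nrm_add: "x \<in> carrier R \<Longrightarrow> y \<in> carrier R \<Longrightarrow> nrm (x \<oplus> y) \<le> nrm x + nrm y"
    and nrm_minus: "x \<in> carrier R \<Longrightarrow> nrm (\<ominus> x) = nrm x"
    and small_nonzero: "0 < e \<Longrightarrow> \<exists>x\<in>carrier R. x \<noteq> \<zero> \<and> nrm x < e"
    and two_nonzero: "\<one> \<oplus> \<one> \<noteq> \<zero>"
    and sqrt_near_one: "0 < e \<Longrightarrow> \<exists>d>0. \<forall>h\<in>carrier R. nrm h < d \<longrightarrow>
           (\<exists>r\<in>carrier R. nrm r < e \<and> (\<one> \<oplus> r) \<otimes> (\<one> \<oplus> r) = \<one> \<oplus> h)"
begin

section \<open>The affine map and its algebraic identities\<close>

text \<open>The map $f$ in the chart $z = 1$.\<close>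

fun f_aff :: "'a \<times> 'a \<Rightarrow> 'a \<times> 'a" where
  "f_aff (x, y) = (x \<otimes> x \<oplus> y, x \<otimes> x \<oplus> y \<otimes> y \<oplus> y)"

declare f_aff.simps [simp del]

text \<open>With x = a z and y = - a^2 w, the first coordinate is a^2 (z^2 - w) = a^2 \<mu>, and y^2
  = a^4 w^2. Pulling a out of y gives the point the shape (a (1 + s), a k) that is used again at the
  next step back.\<close>

lemma f_aff_factored:
  assumes c: "a \<in> carrier R" "w \<in> carrier R" "z \<in> carrier R" "\<mu> \<in> carrier R"
    and z: "z \<otimes> z = w \<oplus> \<mu>"
  shows "f_aff (a \<otimes> z, a \<otimes> \<ominus> (a \<otimes> w)) =
    (a \<otimes> a \<otimes> \<mu>, a \<otimes> a \<otimes> \<mu> \<oplus> a \<otimes> a \<otimes> (a \<otimes> a) \<otimes> (w \<otimes> w))"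
proof -
  have x: "a \<otimes> z \<otimes> (a \<otimes> z) = a \<otimes> a \<otimes> (w \<oplus> \<mu>)"
    using c by (simp add: m_ac flip: z)
  have y: "a \<otimes> \<ominus> (a \<otimes> w) = \<ominus> (a \<otimes> a \<otimes> w)"
    using c by (simp add: r_minus m_assoc)
  have yy: "\<ominus> (a \<otimes> a \<otimes> w) \<otimes> \<ominus> (a \<otimes> a \<otimes> w) = a \<otimes> a \<otimes> (a \<otimes> a) \<otimes> (w \<otimes> w)"
    using c by (simp add: l_minus r_minus m_ac)
  have *: "A \<otimes> (w \<oplus> \<mu>) \<oplus> \<ominus> (A \<otimes> w) = A \<otimes> \<mu>"
    "A \<otimes> (w \<oplus> \<mu>) \<oplus> B \<oplus> \<ominus> (A \<otimes> w) = A \<otimes> \<mu> \<oplus> B" if "A \<in> carrier R" "B \<in> carrier R" for A B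
    using c that by algebra+
  show ?thesis
    unfolding f_aff.simps x y yy using c by (simp add: *)
qed

text \<open>These two lemmas instantiate \<open>\<mu>\<close> and \<open>\<kappa>\<close> in \<open>f_aff_preimage\<close> below so that the image is
  \<open>(- a\<^sup>4 (1 + h), - a\<^sup>4 k)\<close>, respectively \<open>(- t (1 + h), t (1 + k))\<close> with \<open>t = a\<^sup>4 / 2\<close>.\<close>

lemma coefficient_identities:
  assumes "a \<in> carrier R" "h \<in> carrier R" "k \<in> carrier R"
  shows "a \<otimes> a \<otimes> \<ominus> (a \<otimes> a \<otimes> (\<one> \<oplus> h)) = \<ominus> (a \<otimes> a \<otimes> (a \<otimes> a)) \<otimes> (\<one> \<oplus> h)"
   "a \<otimes> a \<otimes> \<ominus> (a \<otimes> a \<otimes> (\<one> \<oplus> h)) \<oplus> a \<otimes> a \<otimes> (a \<otimes> a) \<otimes> (\<one> \<oplus> (h \<oplus> \<ominus> k)) = \<ominus> (a \<otimes> a \<otimes> (a \<otimes> a)) \<otimes> k"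
proof -
  have "A \<otimes> \<ominus> (A \<otimes> (\<one> \<oplus> h)) = \<ominus> (A \<otimes> A) \<otimes> (\<one> \<oplus> h)"
    "A \<otimes> \<ominus> (A \<otimes> (\<one> \<oplus> h)) \<oplus> A \<otimes> A \<otimes> (\<one> \<oplus> (h \<oplus> \<ominus> k)) = \<ominus> (A \<otimes> A) \<otimes> k"
    if "A \<in> carrier R" for A
    using assms that by algebra+
  from this[of "a \<otimes> a"] assms show
    "a \<otimes> a \<otimes> \<ominus> (a \<otimes> a \<otimes> (\<one> \<oplus> h)) = \<ominus> (a \<otimes> a \<otimes> (a \<otimes> a)) \<otimes> (\<one> \<oplus> h)"
    "a \<otimes> a \<otimes> \<ominus> (a \<otimes> a \<otimes> (\<one> \<oplus> h)) \<oplus> a \<otimes> a \<otimes> (a \<otimes> a) \<otimes> (\<one> \<oplus> (h \<oplus> \<ominus> k)) = \<ominus> (a \<otimes> a \<otimes> (a \<otimes> a)) \<otimes> k"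
    by simp_all
qed

lemma reflected_coefficient_identities:
  assumes c: "A \<in> carrier R" "h \<in> carrier R" "k \<in> carrier R" "q \<in> carrier R" and q: "q \<oplus> q = \<one>"
  shows "A \<otimes> \<ominus> (A \<otimes> q \<otimes> (\<one> \<oplus> h)) = \<ominus> (A \<otimes> A \<otimes> q \<otimes> (\<one> \<oplus> h))"
   "A \<otimes> \<ominus> (A \<otimes> q \<otimes> (\<one> \<oplus> h)) \<oplus> A \<otimes> A \<otimes> (\<one> \<oplus> q \<otimes> (h \<oplus> k)) = A \<otimes> A \<otimes> q \<otimes> (\<one> \<oplus> k)"
proof -
  show *: "A \<otimes> \<ominus> (A \<otimes> q \<otimes> (\<one> \<oplus> h)) = \<ominus> (A \<otimes> A \<otimes> q \<otimes> (\<one> \<oplus> h))"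
    using c by (simp add: r_minus m_assoc)
  have "\<ominus> (B \<otimes> q \<otimes> (\<one> \<oplus> h)) \<oplus> B \<otimes> ((q \<oplus> q) \<oplus> q \<otimes> (h \<oplus> k)) = B \<otimes> q \<otimes> (\<one> \<oplus> k)"
    if "B \<in> carrier R" for B
    using c that by algebra
  from this[of "A \<otimes> A"]
  show "A \<otimes> \<ominus> (A \<otimes> q \<otimes> (\<one> \<oplus> h)) \<oplus> A \<otimes> A \<otimes> (\<one> \<oplus> q \<otimes> (h \<oplus> k)) = A \<otimes> A \<otimes> q \<otimes> (\<one> \<oplus> k)"
    unfolding q * using c by simp
qed

text \<open>The linear part of \<open>f_aff\<close> at the origin is (x, y) to (y, y), so both new
  relative errors are k plus terms divisible by t.\<close>

lemma f_aff_diagonal: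
  assumes c: "t \<in> carrier R" "h \<in> carrier R" "k \<in> carrier R"
  shows "f_aff (t \<otimes> (\<one> \<oplus> h), t \<otimes> (\<one> \<oplus> k)) =
   (t \<otimes> (\<one> \<oplus> (k \<oplus> t \<otimes> ((\<one> \<oplus> h) \<otimes> (\<one> \<oplus> h)))),
   t \<otimes> (\<one> \<oplus> (k \<oplus> t \<otimes> ((\<one> \<oplus> h) \<otimes> (\<one> \<oplus> h)) \<oplus> t \<otimes> ((\<one> \<oplus> k) \<otimes> (\<one> \<oplus> k)))))"
  unfolding f_aff.simps prod.inject using c by (intro conjI; algebra)

lemma f_aff_closed: "v \<in> carrier R \<times> carrier R \<Longrightarrow> f_aff v \<in> carrier R \<times> carrier R"
  by (cases v) (auto simp: f_aff.simps)

lemma f_aff_funpow_closed: "v \<in> carrier R \<times> carrier R \<Longrightarrow> (f_aff ^^ m) v \<in> carrier R \<times> carrier R"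
proof (induction m)
  case (Suc m)
  then show ?case using f_aff_closed[of "(f_aff ^^ m) v"] by simp
qed simp

section \<open>Preimages close to the origin\<close>

lemma nrm_one_add_lt:
  assumes "x \<in> carrier R" "nrm x < 1" shows "nrm (\<one> \<oplus> x) < 2"
  using nrm_add[of \<one> x] assms by (simp add: nrm_one)

lemma nrm_mult_one_add_lt:
  assumes "a \<in> carrier R" "x \<in> carrier R" "nrm x < 1" "nrm a < e"
  shows "nrm (a \<otimes> (\<one> \<oplus> x)) < 2 * e"
proof -
  have "nrm (a \<otimes> (\<one> \<oplus> x)) \<le> nrm a * 2"
    unfolding nrm_mult[OF assms(1) add.m_closed[OF one_closed assms(2)]]
    using nrm_one_add_lt[OF assms(2,3)] nrm_nonneg[OF assms(1)] by (intro mult_left_mono) auto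
  with assms(4) show ?thesis by simp
qed

text \<open>Two square roots suffice: 1 + r of 1 + \<kappa>, then 1 + s of 1 + r + \<mu>. They serve
  as w and z in \<open>f_aff_factored\<close>, so k is - a (1 + r), which is small because a is. The
  bound d does not depend on a.\<close>

lemma f_aff_preimage:
  assumes "0 < e"
  obtains d where "0 < d"
    "\<And>a \<mu> \<kappa>. \<lbrakk>a \<in> carrier R; \<mu> \<in> carrier R; \<kappa> \<in> carrier R; nrm a < d; nrm \<mu> < d; nrm \<kappa> < d\<rbrakk> \<Longrightarrow>
       \<exists>s\<in>carrier R. \<exists>k\<in>carrier R. nrm s < e \<and> nrm k < e \<and>
         f_aff (a \<otimes> (\<one> \<oplus> s), a \<otimes> k) =
           (a \<otimes> a \<otimes> \<mu>, a \<otimes> a \<otimes> \<mu> \<oplus> a \<otimes> a \<otimes> (a \<otimes> a) \<otimes> (\<one> \<oplus> \<kappa>))"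
proof -
  obtain d1 where d1: "0 < d1" "\<And>h. h \<in> carrier R \<Longrightarrow> nrm h < d1 \<Longrightarrow>
      \<exists>r\<in>carrier R. nrm r < e \<and> (\<one> \<oplus> r) \<otimes> (\<one> \<oplus> r) = \<one> \<oplus> h"
    using sqrt_near_one[OF assms] by blast
  \<comment> \<open>The bound d1 / 2 on r leaves room for \<mu> under the second root, and the bound
    1 gives \<open>nrm (\<one> \<oplus> r) < 2\<close>.\<close>
  obtain d2 where d2: "0 < d2" "\<And>h. h \<in> carrier R \<Longrightarrow> nrm h < d2 \<Longrightarrow>
      \<exists>r\<in>carrier R. nrm r < min (d1 / 2) 1 \<and> (\<one> \<oplus> r) \<otimes> (\<one> \<oplus> r) = \<one> \<oplus> h"
    using sqrt_near_one[of "min (d1 / 2) 1"] d1(1) by auto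
  show ?thesis
  proof (rule that[of "min d2 (min (d1 / 2) (e / 2))"])
    show "0 < min d2 (min (d1 / 2) (e / 2))" using assms d1(1) d2(1) by simp
    fix a \<mu> \<kappa>
    assume c: "a \<in> carrier R" "\<mu> \<in> carrier R" "\<kappa> \<in> carrier R"
      and a: "nrm a < min d2 (min (d1 / 2) (e / 2))"
      and \<mu>: "nrm \<mu> < min d2 (min (d1 / 2) (e / 2))"
      and \<kappa>: "nrm \<kappa> < min d2 (min (d1 / 2) (e / 2))"
    obtain r where r: "r \<in> carrier R" "nrm r < d1 / 2" "nrm r < 1"
      "(\<one> \<oplus> r) \<otimes> (\<one> \<oplus> r) = \<one> \<oplus> \<kappa>"
      using d2(2)[OF c(3)] \<kappa> by auto
    have "nrm (r \<oplus> \<mu>) < d1"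
      using nrm_add[OF r(1) c(2)] r(2) \<mu> by simp
    then obtain s where s: "s \<in> carrier R" "nrm s < e" "(\<one> \<oplus> s) \<otimes> (\<one> \<oplus> s) = \<one> \<oplus> (r \<oplus> \<mu>)"
      using d1(2)[of "r \<oplus> \<mu>"] r(1) c(2) by auto
    have "nrm (\<ominus> (a \<otimes> (\<one> \<oplus> r))) < e"
      using nrm_mult_one_add_lt[OF c(1) r(1,3), of "e / 2"] a c(1) r(1) by (simp add: nrm_minus)
    then show "\<exists>s\<in>carrier R. \<exists>k\<in>carrier R. nrm s < e \<and> nrm k < e \<and>
         f_aff (a \<otimes> (\<one> \<oplus> s), a \<otimes> k) =
           (a \<otimes> a \<otimes> \<mu>, a \<otimes> a \<otimes> \<mu> \<oplus> a \<otimes> a \<otimes> (a \<otimes> a) \<otimes> (\<one> \<oplus> \<kappa>))"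
      using f_aff_factored[of a "\<one> \<oplus> r" "\<one> \<oplus> s" \<mu>] s r(1,4) c a_assoc[of \<one> r \<mu>] by (metis a_inv_closed a_closed m_closed one_closed)
  qed
qed

section \<open>Iterated preimages\<close>

text \<open>If \<open>u \<sim> - a\<^sup>4\<close> and \<open>v = o(u)\<close>, then \<open>v - u \<sim> a\<^sup>4\<close> has a square root \<open>y \<sim> - a\<^sup>2\<close>, and
  \<open>u - y \<sim> a\<^sup>2\<close> has a square root \<open>x \<sim> a\<close>. So \<open>(u, v)\<close> is the image of \<open>(x, y)\<close>, where again
  \<open>y = o(x)\<close>, and the step can be repeated if \<open>a\<close> is in turn of the form \<open>- b\<^sup>4\<close>.\<close>

fun seeds :: "nat \<Rightarrow> 'a set" where
  "seeds 0 = carrier R - {\<zero>}"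
| "seeds (Suc m) = (\<lambda>a. \<ominus> (a \<otimes> a \<otimes> (a \<otimes> a))) ` seeds m"

lemma seeds_subset: "seeds m \<subseteq> carrier R - {\<zero>}"
proof (induction m)
  case (Suc m)
  show ?case
  proof
    fix b assume "b \<in> seeds (Suc m)"
    then obtain a where a: "a \<in> carrier R" "a \<noteq> \<zero>" "b = \<ominus> (a \<otimes> a \<otimes> (a \<otimes> a))"
      using Suc by auto
    then show "b \<in> carrier R - {\<zero>}"
      by (metis Diff_iff a_inv_closed add.inv_eq_1_iff empty_iff insert_iff integral m_closed)
  qed
qed simp

lemma nrm_sq_le:
  assumes "a \<in> carrier R" "nrm a < 1" shows "nrm (a \<otimes> a) \<le> nrm a"
  using assms nrm_nonneg[OF assms(1)] by (simp add: nrm_mult mult_left_le)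

text \<open>On elements of absolute value below 1 the map taking a to - a^4 does not increase the
  absolute value, so small seeds of order m yield small seeds of order m + 1.\<close>

lemma seeds_small: "0 < e \<Longrightarrow> \<exists>a\<in>seeds m. nrm a < e"
proof (induction m arbitrary: e)
  case 0
  then show ?case using small_nonzero[of e] by auto
next
  case (Suc m)
  obtain a where a: "a \<in> seeds m" "nrm a < min e 1"
    using Suc.IH[of "min e 1"] Suc.prems by auto
  have ac: "a \<in> carrier R" using a(1) seeds_subset by blast
  have "nrm (\<ominus> (a \<otimes> a \<otimes> (a \<otimes> a))) \<le> nrm (a \<otimes> a)"
    using nrm_sq_le[of "a \<otimes> a"] nrm_sq_le[of a] ac a(2) by (simp add: nrm_minus)
  also have "\<dots> < e"
    using nrm_sq_le[of a] ac a(2) by simp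
  finally show ?case using a(1) by auto
qed

text \<open>A seed of order m + 1 is - a^4 with a of order m. One step back leads to (a (1 + s), a
  l), which the induction hypothesis covers once s and l are small enough; hence its e is fixed
  before d is chosen.\<close>

lemma funpow_f_aff_image:
  "\<exists>e>0. \<forall>a\<in>seeds m. \<forall>h\<in>carrier R. \<forall>k\<in>carrier R. nrm a < e \<longrightarrow> nrm h < e \<longrightarrow> nrm k < e \<longrightarrow>
     (a \<otimes> (\<one> \<oplus> h), a \<otimes> k) \<in> (f_aff ^^ m) ` (carrier R \<times> carrier R)"
proof (induction m)
  case 0
  show ?case by (intro exI[of _ 1]) auto
next
  case (Suc m)
  then obtain e where e: "0 < e"
    and IH: "\<And>a h k. \<lbrakk>a \<in> seeds m; h \<in> carrier R; k \<in> carrier R; nrm a < e; nrm h < e; nrm k < e\<rbrakk> \<Longrightarrow>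
     (a \<otimes> (\<one> \<oplus> h), a \<otimes> k) \<in> (f_aff ^^ m) ` (carrier R \<times> carrier R)" by blast
  obtain d where d: "0 < d"
    "\<And>a \<mu> \<kappa>. \<lbrakk>a \<in> carrier R; \<mu> \<in> carrier R; \<kappa> \<in> carrier R; nrm a < d; nrm \<mu> < d; nrm \<kappa> < d\<rbrakk> \<Longrightarrow>
       \<exists>s\<in>carrier R. \<exists>k\<in>carrier R. nrm s < e \<and> nrm k < e \<and>
         f_aff (a \<otimes> (\<one> \<oplus> s), a \<otimes> k) =
           (a \<otimes> a \<otimes> \<mu>, a \<otimes> a \<otimes> \<mu> \<oplus> a \<otimes> a \<otimes> (a \<otimes> a) \<otimes> (\<one> \<oplus> \<kappa>))"
    using f_aff_preimage[OF e] by metis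
  \<comment> \<open>The bound e is for the induction hypothesis at a, the bound 1 for
    \<open>nrm_sq_le\<close>, and the halving of d absorbs the factor 2 from 1 + h as well as the
    two summands of h - k.\<close>
  define d' where "d' = min (min e 1) (d / 2)"
  have d': "0 < d'" "d' \<le> e" "d' \<le> 1" "d' \<le> d / 2" using d(1) e by (auto simp: d'_def)
  have main: "(\<ominus> (a \<otimes> a \<otimes> (a \<otimes> a)) \<otimes> (\<one> \<oplus> h), \<ominus> (a \<otimes> a \<otimes> (a \<otimes> a)) \<otimes> k)
      \<in> (f_aff ^^ Suc m) ` (carrier R \<times> carrier R)"
    if a: "a \<in> seeds m" and h: "h \<in> carrier R" and k: "k \<in> carrier R"
      and lt: "nrm (\<ominus> (a \<otimes> a \<otimes> (a \<otimes> a))) < d' ^ 4" "nrm h < d'" "nrm k < d'" for a h k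
  proof -
    have ac: "a \<in> carrier R" using a seeds_subset by blast
    \<comment> \<open>Smallness is given for the seed - a^4; a fourth root transfers it to
      a.\<close>
    have "nrm a ^ 4 < d' ^ 4"
      using lt(1) ac by (simp add: nrm_minus nrm_mult power4_eq_xxxx mult.assoc)
    then have na: "nrm a < d'"
      by (rule power_less_imp_less_base) (use d' in simp)
    have "nrm (a \<otimes> a) < d'" using nrm_sq_le[OF ac] na d'(3) by simp
    then have "nrm (\<ominus> (a \<otimes> a \<otimes> (\<one> \<oplus> h))) < d"
      using nrm_mult_one_add_lt[of "a \<otimes> a" h d'] ac h lt(2) d' by (simp add: nrm_minus)
    \<comment> \<open>For u = - a^4 (1 + h) and v = - a^4 k the difference v - u is a^4 (1 + h - k),
      so h - k plays the role of \<kappa>.\<close>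
    moreover have "nrm (h \<oplus> \<ominus> k) < d"
      using nrm_add[of h "\<ominus> k"] h k lt d' by (simp add: nrm_minus)
    moreover have "nrm a < d" using na d' d(1) by simp
    ultimately obtain s l where sl: "s \<in> carrier R" "l \<in> carrier R" "nrm s < e" "nrm l < e"
      "f_aff (a \<otimes> (\<one> \<oplus> s), a \<otimes> l) =
        (\<ominus> (a \<otimes> a \<otimes> (a \<otimes> a)) \<otimes> (\<one> \<oplus> h), \<ominus> (a \<otimes> a \<otimes> (a \<otimes> a)) \<otimes> k)"
      using d(2)[of a "\<ominus> (a \<otimes> a \<otimes> (\<one> \<oplus> h))" "h \<oplus> \<ominus> k"] ac h k
      unfolding coefficient_identities(2)[OF ac h k] unfolding coefficient_identities(1)[OF ac h k] by blast
    obtain v where "v \<in> carrier R \<times> carrier R" "(a \<otimes> (\<one> \<oplus> s), a \<otimes> l) = (f_aff ^^ m) v"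
      using IH[OF a sl(1,2) _ sl(3,4)] na d'(2) by auto
    then show ?thesis
      by (intro image_eqI[of _ _ v]) (simp_all flip: sl(5))
  qed
  show ?case
  proof (intro exI[of _ "min d' (d' ^ 4)"] conjI ballI impI)
    show "0 < min d' (d' ^ 4)" using d'(1) by simp
  next
    fix b h k
    assume "b \<in> seeds (Suc m)" and h: "h \<in> carrier R" "k \<in> carrier R"
      and lt: "nrm b < min d' (d' ^ 4)" "nrm h < min d' (d' ^ 4)" "nrm k < min d' (d' ^ 4)"
    then obtain a where "a \<in> seeds m" "b = \<ominus> (a \<otimes> a \<otimes> (a \<otimes> a))" by auto
    with main[of a h k] h lt show "(b \<otimes> (\<one> \<oplus> h), b \<otimes> k) \<in> (f_aff ^^ Suc m) ` (carrier R \<times> carrier R)"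
      by simp
  qed
qed

section \<open>Iterates of points on the diagonal\<close>

lemma funpow_f_aff_diagonal:
  "0 < e \<Longrightarrow> \<exists>d>0. \<forall>t\<in>carrier R. nrm t < d \<longrightarrow> (\<exists>h\<in>carrier R. \<exists>k\<in>carrier R.
     nrm h < e \<and> nrm k < e \<and> (f_aff ^^ m) (t, t) = (t \<otimes> (\<one> \<oplus> h), t \<otimes> (\<one> \<oplus> k)))"
proof (induction m arbitrary: e)
  case 0
  have "nrm \<zero> = 0"
  proof -
    \<comment> \<open>From \<open>nrm \<zero> = nrm \<zero> * nrm x\<close> with
      \<open>nrm x < 1\<close> it follows that \<open>nrm \<zero> = 0\<close>.\<close>
    obtain x where "x \<in> carrier R" "nrm x < 1" using small_nonzero[of 1] by auto
    then show ?thesis using nrm_mult[of \<zero> x] by simp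
  qed
  with 0 show ?case by (intro exI[of _ 1]) (auto intro!: bexI[of _ \<zero>])
next
  case (Suc m)
  define e' where "e' = min 1 (e / 2)"
  obtain d where d: "0 < d" and IH: "\<And>t. \<lbrakk>t \<in> carrier R; nrm t < d\<rbrakk> \<Longrightarrow> \<exists>h\<in>carrier R. \<exists>k\<in>carrier R.
     nrm h < e' \<and> nrm k < e' \<and> (f_aff ^^ m) (t, t) = (t \<otimes> (\<one> \<oplus> h), t \<otimes> (\<one> \<oplus> k))"
    using Suc.IH[of e'] Suc.prems by (auto simp: e'_def)
  show ?case
  \<comment> \<open>As h and k are below 1 in absolute value, each term t (1 + h)^2 or t (1 + k)^2
    is below 4 (e / 16) = e / 4. Two such terms and the old error, below e / 2, add up to less than
    e.\<close>
  proof (intro exI[of _ "min d (e / 16)"] conjI ballI impI)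
    show "0 < min d (e / 16)" using d Suc.prems by simp
    fix t assume t: "t \<in> carrier R" "nrm t < min d (e / 16)"
    then obtain h k where hk: "h \<in> carrier R" "k \<in> carrier R" "nrm h < e'" "nrm k < e'"
      "(f_aff ^^ m) (t, t) = (t \<otimes> (\<one> \<oplus> h), t \<otimes> (\<one> \<oplus> k))"
      using IH[of t] by auto
    have sq: "nrm (t \<otimes> ((\<one> \<oplus> x) \<otimes> (\<one> \<oplus> x))) < e / 4" if x: "x \<in> carrier R" "nrm x < e'" for x
    proof -
      have "nrm (t \<otimes> (\<one> \<oplus> x) \<otimes> (\<one> \<oplus> x)) < 2 * (2 * (e / 16))"
        using x t by (intro nrm_mult_one_add_lt) (auto simp: e'_def)
      with x t show ?thesis by (simp add: m_assoc)
    qed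
    let ?h = "k \<oplus> t \<otimes> ((\<one> \<oplus> h) \<otimes> (\<one> \<oplus> h))"
    let ?k = "?h \<oplus> t \<otimes> ((\<one> \<oplus> k) \<otimes> (\<one> \<oplus> k))"
    have c: "?h \<in> carrier R" "?k \<in> carrier R" using hk t by auto
    have h: "nrm ?h < e' + e / 4"
      using nrm_add[of k "t \<otimes> ((\<one> \<oplus> h) \<otimes> (\<one> \<oplus> h))"] hk t sq[of h] by simp
    moreover have "nrm ?k < e' + e / 4 + e / 4"
      using nrm_add[of ?h "t \<otimes> ((\<one> \<oplus> k) \<otimes> (\<one> \<oplus> k))"] h hk t sq[of k] by simp
    ultimately have "nrm ?h < e" "nrm ?k < e" using Suc.prems by (auto simp: e'_def)
    moreover have "(f_aff ^^ Suc m) (t, t) = (t \<otimes> (\<one> \<oplus> ?h), t \<otimes> (\<one> \<oplus> ?k))"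
      using f_aff_diagonal[OF t(1) hk(1,2)] hk(5) by simp
    ultimately show "\<exists>h\<in>carrier R. \<exists>k\<in>carrier R.
        nrm h < e \<and> nrm k < e \<and> (f_aff ^^ Suc m) (t, t) = (t \<otimes> (\<one> \<oplus> h), t \<otimes> (\<one> \<oplus> k))"
      using c by blast
  qed
qed

section \<open>The collision in the affine chart\<close>

lemma affine_collision:
  obtains v w where "v \<in> carrier R \<times> carrier R" "w \<in> carrier R \<times> carrier R"
    "(f_aff ^^ m) v \<noteq> (f_aff ^^ m) w" "(f_aff ^^ Suc m) v = (f_aff ^^ Suc m) w"
proof -
  define q where "q = inv (\<one> \<oplus> \<one>)"
  have q: "q \<in> carrier R" "q \<oplus> q = \<one>" "q \<noteq> \<zero>"
  proof -
    have U: "\<one> \<oplus> \<one> \<in> Units R" using two_nonzero field_Units by auto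
    then show qc: "q \<in> carrier R" by (simp add: q_def)
    have "q \<otimes> (\<one> \<oplus> \<one>) = \<one>" using U by (simp add: q_def)
    then show "q \<oplus> q = \<one>" using qc by (simp add: r_distr)
    then show "q \<noteq> \<zero>" by auto
  qed
  obtain e where e: "0 < e"
    and im: "\<And>a h k. \<lbrakk>a \<in> seeds m; h \<in> carrier R; k \<in> carrier R; nrm a < e; nrm h < e; nrm k < e\<rbrakk> \<Longrightarrow>
     (a \<otimes> (\<one> \<oplus> h), a \<otimes> k) \<in> (f_aff ^^ m) ` (carrier R \<times> carrier R)"
    using funpow_f_aff_image[of m] by blast
  obtain d where d: "0 < d"
    "\<And>a \<mu> \<kappa>. \<lbrakk>a \<in> carrier R; \<mu> \<in> carrier R; \<kappa> \<in> carrier R; nrm a < d; nrm \<mu> < d; nrm \<kappa> < d\<rbrakk> \<Longrightarrow>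
       \<exists>s\<in>carrier R. \<exists>k\<in>carrier R. nrm s < e \<and> nrm k < e \<and>
         f_aff (a \<otimes> (\<one> \<oplus> s), a \<otimes> k) =
           (a \<otimes> a \<otimes> \<mu>, a \<otimes> a \<otimes> \<mu> \<oplus> a \<otimes> a \<otimes> (a \<otimes> a) \<otimes> (\<one> \<oplus> \<kappa>))"
    using f_aff_preimage[OF e] by metis
  \<comment> \<open>The absolute value of q = 1/2 may exceed 1, as it does for p = 2, so thresholds
    are divided by a bound C for it.\<close>
  define C where "C = nrm q + 1"
  have C: "1 \<le> C" "nrm q \<le> C" using nrm_nonneg[OF q(1)] by (auto simp: C_def)
  obtain d2 where d2: "0 < d2" "\<And>t. \<lbrakk>t \<in> carrier R; nrm t < d2\<rbrakk> \<Longrightarrow> \<exists>h\<in>carrier R. \<exists>k\<in>carrier R.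
     nrm h < min 1 (d / (2 * C)) \<and> nrm k < min 1 (d / (2 * C)) \<and>
     (f_aff ^^ m) (t, t) = (t \<otimes> (\<one> \<oplus> h), t \<otimes> (\<one> \<oplus> k))"
    using funpow_f_aff_diagonal[of "min 1 (d / (2 * C))" m] d(1) C by auto
  \<comment> \<open>In order: e for \<open>im\<close>, 1 for \<open>nrm_sq_le\<close>, d for a in
    the preimage step, d / (2 C) for its coefficient \<mu>, and d2 / C for the diagonal estimate at
    t.\<close>
  define d3 where "d3 = min (min e 1) (min d (min (d / (2 * C)) (d2 / C)))"
  have "0 < d3" using e d d2 C by (simp add: d3_def)
  then obtain a where a: "a \<in> seeds m" "nrm a < d3" using seeds_small by blast
  have ac: "a \<in> carrier R" "a \<noteq> \<zero>" using a(1) seeds_subset by auto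
  define A where "A = a \<otimes> a"
  have A: "A \<in> carrier R" "A \<noteq> \<zero>" "nrm A \<le> nrm a" "nrm (A \<otimes> A) \<le> nrm a"
    using ac a(2) nrm_sq_le[of a] nrm_sq_le[of A] integral_iff[of a a] by (auto simp: A_def d3_def)
  \<comment> \<open>Halving makes t + t = a^4. Thus v - (- u) = t (1 + k) + t (1 + h) equals a^4 (1
    + q (h + k)), a square times a number near 1.\<close>
  define t where "t = A \<otimes> A \<otimes> q"
  have t: "t \<in> carrier R" "t \<noteq> \<zero>" using A q by (auto simp: t_def integral_iff)
  have "nrm t \<le> nrm a * C"
    unfolding t_def using A q C nrm_nonneg ac by (subst nrm_mult) (auto intro!: mult_mono)
  also have "\<dots> < d2 / C * C"
    using a(2) C by (intro mult_strict_right_mono) (auto simp: d3_def)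
  finally have "nrm t < d2" using C by simp
  then obtain h k where hk: "h \<in> carrier R" "k \<in> carrier R"
    "nrm h < 1" "nrm h < d / (2 * C)" "nrm k < d / (2 * C)"
    "(f_aff ^^ m) (t, t) = (t \<otimes> (\<one> \<oplus> h), t \<otimes> (\<one> \<oplus> k))"
    using d2(2)[OF t(1)] by auto
  have nq: "nrm q * x < y" if "0 \<le> x" "x < y / C" for x y
  proof -
    have "nrm q * x \<le> C * x" using that(1) C(2) by (intro mult_right_mono)
    also have "\<dots> < y" using that(2) C(1) by (simp add: field_simps)
    finally show ?thesis .
  qed
  have "nrm (h \<oplus> k) < d / C"
    using nrm_add[OF hk(1,2)] hk(4,5) by simp
  then have "nrm (q \<otimes> (h \<oplus> k)) < d"
    using nq[of "nrm (h \<oplus> k)" d] hk q by (simp add: nrm_mult nrm_nonneg)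
  moreover have "nrm (\<ominus> (A \<otimes> q \<otimes> (\<one> \<oplus> h))) < d"
  proof -
    have "nrm A < d / 2 / C" using A(3) a(2) by (simp add: d3_def)
    then have "nrm (A \<otimes> q) < d / 2"
      using nq[of "nrm A" "d / 2"] A(1) q(1) by (simp add: nrm_mult nrm_nonneg mult.commute)
    then show ?thesis
      using nrm_mult_one_add_lt[of "A \<otimes> q" h "d / 2"] A(1) q(1) hk(1,3) by (simp add: nrm_minus)
  qed
  moreover have "nrm a < d" using a(2) by (simp add: d3_def)
  ultimately obtain s l where sl: "s \<in> carrier R" "l \<in> carrier R" "nrm s < e" "nrm l < e"
      "f_aff (a \<otimes> (\<one> \<oplus> s), a \<otimes> l) = (\<ominus> (t \<otimes> (\<one> \<oplus> h)), t \<otimes> (\<one> \<oplus> k))"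
    using d(2)[of a "\<ominus> (A \<otimes> q \<otimes> (\<one> \<oplus> h))" "q \<otimes> (h \<oplus> k)"] ac A q hk
    unfolding A_def[symmetric] reflected_coefficient_identities(2)[OF A(1) hk(1,2) q(1,2)]
    unfolding reflected_coefficient_identities(1)[OF A(1) hk(1,2) q(1,2)] t_def[symmetric] by blast
  obtain w where w: "w \<in> carrier R \<times> carrier R" "(a \<otimes> (\<one> \<oplus> s), a \<otimes> l) = (f_aff ^^ m) w"
    using im[OF a(1) sl(1,2) _ sl(3,4)] a(2) by (auto simp: d3_def)
  let ?u = "t \<otimes> (\<one> \<oplus> h)" and ?v = "t \<otimes> (\<one> \<oplus> k)"
  \<comment> \<open>Going back m + 1 steps from (- u, v) gives w, so \<open>f_aff w\<close> is the
    point m steps back, to be compared with (t, t).\<close>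
  have Fw: "(f_aff ^^ m) (f_aff w) = (\<ominus> ?u, ?v)"
    using sl(5) w(2) by (simp flip: funpow_swap1)
  have "\<one> \<oplus> h \<noteq> \<zero>"
  proof
    assume "\<one> \<oplus> h = \<zero>"
    then have "\<ominus> h = \<one>" using hk(1) by (simp add: minus_equality)
    then show False using hk(1,3) nrm_minus[of h] nrm_one by simp
  qed
  then have u: "?u \<in> carrier R" "?u \<noteq> \<zero>" using t hk(1) by (auto simp: integral_iff)
  have "?u \<noteq> \<ominus> ?u"
  proof
    assume "?u = \<ominus> ?u"
    then have "?u \<oplus> ?u = \<zero>" using u(1) r_neg by metis
    then have "?u \<otimes> (\<one> \<oplus> \<one>) = \<zero>" using u(1) by (simp add: r_distr)
    then show False using u two_nonzero integral_iff[of ?u "\<one> \<oplus> \<one>"] by simp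
  qed
  moreover have "f_aff (\<ominus> ?u, ?v) = f_aff (?u, ?v)"
    using u(1) by (simp add: f_aff.simps l_minus r_minus)
  ultimately show ?thesis
    using that[of "(t, t)" "f_aff w"] t(1) f_aff_closed[OF w(1)] Fw hk(6) by simp
qed

section \<open>From the chart to the projective plane\<close>

definition affine_point :: "'a \<times> 'a \<Rightarrow> ('a \<times> 'a \<times> 'a) set" where
  "affine_point v = proj_rel R `` {(fst v, snd v, \<one>)}"

lemma affine_point_nonzero: "v \<in> carrier R \<times> carrier R \<Longrightarrow> (fst v, snd v, \<one>) \<in> nonzero_triples R"
  by (auto simp: nonzero_triples_def)

lemma affine_point_closed: "v \<in> carrier R \<times> carrier R \<Longrightarrow> affine_point v \<in> proj_plane R"
  unfolding affine_point_def proj_plane_def by (intro quotientI affine_point_nonzero)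

text \<open>Comparing the third coordinates, both one, forces the scalar c to be one. This keeps
  distinct affine points distinct in the plane.\<close>

lemma inj_on_affine_point: "inj_on affine_point (carrier R \<times> carrier R)"
proof (rule inj_onI)
  fix v w assume vw: "v \<in> carrier R \<times> carrier R" "w \<in> carrier R \<times> carrier R" "affine_point v = affine_point w"
  then have "((fst v, snd v, \<one>), (fst w, snd w, \<one>)) \<in> proj_rel R"
    unfolding affine_point_def using eq_equiv_class[OF _ equiv_proj_rel affine_point_nonzero] by blast
  then obtain c where "c \<in> carrier R" "fst w = c \<otimes> fst v" "snd w = c \<otimes> snd v" "\<one> = c \<otimes> \<one>"
    by (auto simp: proj_rel_def)
  with vw(1) show "v = w" by (auto simp: prod_eq_iff)
qed

lemma f_map_affine_point:
  assumes "v \<in> carrier R \<times> carrier R" shows "f_map R (affine_point v) = affine_point (f_aff v)"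
  using assms f_map_class[OF affine_point_nonzero[OF assms]] by (cases v) (auto simp: affine_point_def f_aff.simps numeral_2_eq_2)

lemma funpow_f_map_affine_point:
  assumes "v \<in> carrier R \<times> carrier R" shows "(f_map R ^^ m) (affine_point v) = affine_point ((f_aff ^^ m) v)"
  using assms f_aff_funpow_closed by (induction m) (simp_all add: f_map_affine_point)

lemma f_map_collision:
  assumes "n \<ge> 1"
  shows "\<exists>a\<in>proj_plane R. \<exists>b\<in>proj_plane R. (f_map R ^^ n) a = (f_map R ^^ n) b \<and>
     (f_map R ^^ (n - 1)) a \<noteq> (f_map R ^^ (n - 1)) b"
proof -
  obtain v w where vw: "v \<in> carrier R \<times> carrier R" "w \<in> carrier R \<times> carrier R"
    "(f_aff ^^ (n - 1)) v \<noteq> (f_aff ^^ (n - 1)) w" "(f_aff ^^ Suc (n - 1)) v = (f_aff ^^ Suc (n - 1)) w"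
    by (rule affine_collision)
  then have "(f_aff ^^ n) v = (f_aff ^^ n) w" using assms by simp
  moreover have "affine_point ((f_aff ^^ (n - 1)) v) \<noteq> affine_point ((f_aff ^^ (n - 1)) w)"
    using vw f_aff_funpow_closed inj_on_affine_point by (meson inj_onD)
  ultimately show ?thesis
    using vw(1,2) by (intro bexI[of _ "affine_point v"] bexI[of _ "affine_point w"]) (simp_all add: funpow_f_map_affine_point affine_point_closed)
qed

end

section \<open>The p-adic numbers through representing sequences\<close>

context
  fixes p :: nat
  assumes p: "Factorial_Ring.prime p"
begin

abbreviation (input) v :: "rat \<Rightarrow> real" where "v \<equiv> padic_abs p"

lemma padic_abs_p: "v (of_nat p) = 1 / real p"
  using padic_abs_fract[OF p, of "int p" 1] prime_gt_0_nat[OF p]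
  by (simp add: multiplicity_prime p power_int_minus divide_inverse)

lemma padic_abs_power: "v (x ^ k) = v x ^ k"
  by (induction k) (simp_all add: padic_abs_mult p)

text \<open>The reverse triangle inequality, by which the absolute values along a p-adic Cauchy
  sequence form a real Cauchy sequence.\<close>

lemma padic_abs_diff_abs: "\<bar>v x - v y\<bar> \<le> v (x - y)"
  using padic_abs_add[OF p, of "x - y" y] padic_abs_add[OF p, of "y - x" x]
    padic_abs_uminus[OF p, of "x - y"] padic_abs_nonneg[OF p, of x] padic_abs_nonneg[OF p, of y] padic_abs_nonneg[OF p, of "x - y"]
  by simp

lemma padic_abs_convergent:
  assumes "S \<in> padic_Cauchy p"
  shows "convergent (\<lambda>n. v (S n))"
proof (rule Cauchy_convergent, rule CauchyI)
  fix e :: real assume "0 < e"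
  then obtain N where "\<And>m n. m \<ge> N \<Longrightarrow> n \<ge> N \<Longrightarrow> v (S m - S n) < e"
    using padic_CauchyD[OF p assms] by blast
  then show "\<exists>M. \<forall>m\<ge>M. \<forall>n\<ge>M. norm (v (S m) - v (S n)) < e"
    using padic_abs_diff_abs by (intro exI[of _ N]) (metis order.strict_trans1 real_norm_def)
qed

definition padic_class :: "(nat \<Rightarrow> rat) \<Rightarrow> (nat \<Rightarrow> rat) set" where
  "padic_class S = padic_null p +>\<^bsub>padic_Cauchy_ring p\<^esub> S"

lemma padic_class_hom: "ring_hom_cring (padic_Cauchy_ring p) (Qp p) padic_class"
  using ideal.rcos_ring_hom_cring[OF ideal_padic_null[OF p] cring_padic_Cauchy_ring[OF p]]
  unfolding Qp_def padic_class_def .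

lemma carrier_Qp: "carrier (Qp p) = padic_class ` padic_Cauchy p"
  by (auto simp: Qp_def FactRing_def A_RCOSETS_def RCOSETS_def padic_class_def a_r_coset_def padic_Cauchy_ring_def)

lemma padic_class_closed: "S \<in> padic_Cauchy p \<Longrightarrow> padic_class S \<in> carrier (Qp p)"
  by (simp add: carrier_Qp)

lemma padic_class_eq: "padic_class S = {\<lambda>n. N n + S n | N. N \<in> padic_null p}"
  by (auto simp: padic_class_def a_r_coset_def r_coset_def padic_Cauchy_ring_def)

lemma padic_class_eqI:
  assumes "S \<in> padic_Cauchy p" "T \<in> padic_Cauchy p" "(\<lambda>n. S n - T n) \<in> padic_null p"
  shows "padic_class S = padic_class T"
proof -
  interpret I: ideal "padic_null p" "padic_Cauchy_ring p" by (rule ideal_padic_null[OF p])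
  have "S \<in> padic_class T" unfolding padic_class_eq using assms(3) by force
  then show ?thesis using I.a_repr_independence'[of S T] assms(2)
    by (auto simp: padic_class_def padic_Cauchy_ring_def)
qed

lemma zero_Qp: "\<zero>\<^bsub>Qp p\<^esub> = padic_null p"
  by (simp add: Qp_def FactRing_def)

lemma padic_class_nonzero:
  assumes "S \<notin> padic_null p" "S \<in> padic_Cauchy p" shows "padic_class S \<noteq> \<zero>\<^bsub>Qp p\<^esub>"
proof
  assume "padic_class S = \<zero>\<^bsub>Qp p\<^esub>"
  moreover have "S \<in> padic_class S" unfolding padic_class_eq using padic_null_0[OF p] by force
  ultimately show False using assms(1) zero_Qp by simp
qed

text \<open>The quotient map is a ring homomorphism, so identities in \<open>Qp p\<close> can be
  checked termwise on representatives.\<close>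

lemma padic_class_one: "padic_class (\<lambda>_. 1) = \<one>\<^bsub>Qp p\<^esub>"
  and padic_class_mult: "S \<in> padic_Cauchy p \<Longrightarrow> T \<in> padic_Cauchy p \<Longrightarrow>
    padic_class S \<otimes>\<^bsub>Qp p\<^esub> padic_class T = padic_class (\<lambda>n. S n * T n)"
  and padic_class_add: "S \<in> padic_Cauchy p \<Longrightarrow> T \<in> padic_Cauchy p \<Longrightarrow>
    padic_class S \<oplus>\<^bsub>Qp p\<^esub> padic_class T = padic_class (\<lambda>n. S n + T n)"
  and padic_class_uminus: "S \<in> padic_Cauchy p \<Longrightarrow> \<ominus>\<^bsub>Qp p\<^esub> padic_class S = padic_class (\<lambda>n. - S n)"
proof -
  interpret h: ring_hom_cring "padic_Cauchy_ring p" "Qp p" padic_class by (rule padic_class_hom)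
  show "padic_class (\<lambda>_. 1) = \<one>\<^bsub>Qp p\<^esub>" using h.hom_one by (simp add: padic_Cauchy_ring_def)
  show "padic_class S \<otimes>\<^bsub>Qp p\<^esub> padic_class T = padic_class (\<lambda>n. S n * T n)" if "S \<in> padic_Cauchy p" "T \<in> padic_Cauchy p"
    using h.hom_mult[of S T] that by (simp add: padic_Cauchy_ring_def)
  show "padic_class S \<oplus>\<^bsub>Qp p\<^esub> padic_class T = padic_class (\<lambda>n. S n + T n)" if "S \<in> padic_Cauchy p" "T \<in> padic_Cauchy p"
    using h.hom_add[of S T] that by (simp add: padic_Cauchy_ring_def)
  show "\<ominus>\<^bsub>Qp p\<^esub> padic_class S = padic_class (\<lambda>n. - S n)" if "S \<in> padic_Cauchy p"
    using h.hom_a_inv[of S] that by (simp add: padic_Cauchy_ring_uminus[OF p])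
      (simp add: padic_Cauchy_ring_def)
qed

section \<open>The absolute value on the p-adic numbers\<close>

text \<open>The chosen representative does not matter: two of them differ by a null sequence, which
  leaves the limit unchanged (\<open>Qp_norm_class\<close>).\<close>

definition Qp_norm :: "(nat \<Rightarrow> rat) set \<Rightarrow> real" where
  "Qp_norm A = lim (\<lambda>n. v ((SOME S. S \<in> A) n))"

lemma Qp_norm_class:
  assumes "S \<in> padic_Cauchy p" shows "(\<lambda>n. v (S n)) \<longlonglongrightarrow> Qp_norm (padic_class S)"
proof -
  define T where "T = (SOME S'. S' \<in> padic_class S)"
  have "\<exists>S'. S' \<in> padic_class S" unfolding padic_class_eq using padic_null_0[OF p] by force
  then have "T \<in> padic_class S" unfolding T_def by (rule someI_ex)
  then obtain N where N: "N \<in> padic_null p" "T = (\<lambda>n. N n + S n)" unfolding padic_class_eq by blast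
  obtain l where l: "(\<lambda>n. v (S n)) \<longlonglongrightarrow> l"
    using padic_abs_convergent[OF assms] by (auto simp: convergent_def)
  have "(\<lambda>n. v (T n) - v (S n)) \<longlonglongrightarrow> 0"
  proof (rule tendsto_0_le)
    show "(\<lambda>n. v (N n)) \<longlonglongrightarrow> 0" using N(1) by (simp add: padic_null_def)
    show "\<forall>\<^sub>F n in sequentially. norm (v (T n) - v (S n)) \<le> norm (v (N n)) * 1"
    proof (rule always_eventually, rule allI)
      fix n
      show "norm (v (T n) - v (S n)) \<le> norm (v (N n)) * 1"
        using padic_abs_diff_abs[of "N n + S n" "S n"] padic_abs_nonneg[OF p, of "N n"]
        unfolding N(2) by simp
    qed
  qed
  from tendsto_add[OF this l] have "(\<lambda>n. v (T n)) \<longlonglongrightarrow> l" by simp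
  then have "Qp_norm (padic_class S) = l" unfolding Qp_norm_def T_def[symmetric] by (rule limI)
  with l show ?thesis by simp
qed

section \<open>Square roots of p-adic numbers close to one\<close>

text \<open>The fixed points \<open>r = (q - r\<^sup>2) / 2\<close> are the solutions of \<open>(1 + r)\<^sup>2 = 1 + q\<close>; the iteration
  contracts as long as $|r|_p \<le> |2|_p / 2$.\<close>

fun sqrt_iter :: "rat \<Rightarrow> nat \<Rightarrow> rat" where
  "sqrt_iter q 0 = 0"
| "sqrt_iter q (Suc n) = (q - sqrt_iter q n * sqrt_iter q n) / 2"

lemma padic_abs_half: "v (x / 2) = v x / v 2"
  by (simp only: divide_inverse padic_abs_mult[OF p] padic_abs_inverse[OF p])

lemma sqrt_iter_bounds:
  assumes r: "0 < r" "r \<le> v 2 / 2" and q: "v q \<le> v 2 * r"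
  shows "v (sqrt_iter q n) \<le> r"
    and "v ((1 + sqrt_iter q n) * (1 + sqrt_iter q n) - (1 + q)) \<le> v 2 * r / 2 ^ n"
proof -
  have c: "0 < v 2" using padic_abs_eq_0_iff[OF p, of 2] padic_abs_nonneg[OF p, of 2] by linarith
  show b: "v (sqrt_iter q n) \<le> r" for n
  proof (induction n)
    case 0
    then show ?case using r p by simp
  next
    case (Suc n)
    have "v (sqrt_iter q n * sqrt_iter q n) \<le> r * r"
      unfolding padic_abs_mult[OF p] using Suc r padic_abs_nonneg[OF p] by (intro mult_mono) auto
    also have "\<dots> \<le> v 2 * r" using r c by (intro mult_right_mono) auto
    finally have "v (q - sqrt_iter q n * sqrt_iter q n) \<le> v 2 * r"
      using padic_abs_diff[OF p, of q "sqrt_iter q n * sqrt_iter q n"] q by simp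
    then show ?case using c by (simp add: padic_abs_half field_simps)
  qed
  show "v ((1 + sqrt_iter q n) * (1 + sqrt_iter q n) - (1 + q)) \<le> v 2 * r / 2 ^ n"
  proof (induction n)
    case 0
    then show ?case using q p by simp
  next
    case (Suc n)
    let ?x = "sqrt_iter q n" and ?y = "sqrt_iter q (Suc n)"
    \<comment> \<open>Since 2y = q - x^2, the residual at x is 2 (x - y) and the one at y is y^2 -
      x^2. The quotient (y + x) / 2 has absolute value at most 1/2 because r is at most half of
      |2|.\<close>
    have "(1 + ?y) * (1 + ?y) - (1 + q) = - (((1 + ?x) * (1 + ?x) - (1 + q)) * ((?y + ?x) / 2))"
      by (simp add: field_simps)
    then have "v ((1 + ?y) * (1 + ?y) - (1 + q)) =
        v ((1 + ?x) * (1 + ?x) - (1 + q)) * (v (?y + ?x) / v 2)"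
      by (simp only: padic_abs_uminus[OF p] padic_abs_mult[OF p] padic_abs_half)
    also have "\<dots> \<le> (v 2 * r / 2 ^ n) * (1 / 2)"
    proof (rule mult_mono[OF Suc])
      have "v (?y + ?x) \<le> v 2 / 2"
        using padic_abs_add[OF p, of ?y ?x] b[of n] b[of "Suc n"] r by simp
      then show "v (?y + ?x) / v 2 \<le> 1 / 2" using c by (simp add: field_simps)
    qed (use r c padic_abs_nonneg[OF p] in auto)
    finally show ?case by simp
  qed
qed

lemma Qp_sqrt:
  assumes e: "0 < e"
  shows "\<exists>d>0. \<forall>h\<in>carrier (Qp p). Qp_norm h < d \<longrightarrow>
     (\<exists>r\<in>carrier (Qp p). Qp_norm r < e \<and>
        (\<one>\<^bsub>Qp p\<^esub> \<oplus>\<^bsub>Qp p\<^esub> r) \<otimes>\<^bsub>Qp p\<^esub> (\<one>\<^bsub>Qp p\<^esub> \<oplus>\<^bsub>Qp p\<^esub> r) = \<one>\<^bsub>Qp p\<^esub> \<oplus>\<^bsub>Qp p\<^esub> h)"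
proof -
  have c: "0 < v 2" using padic_abs_eq_0_iff[OF p, of 2] padic_abs_nonneg[OF p, of 2] by linarith
  \<comment> \<open>Passing to the limit gives only \<open>Qp_norm r \<le> \<rho>\<close>, hence e /
    2 for a strict bound by e; the other term is the contraction range of
    \<open>sqrt_iter\<close>.\<close>
  define \<rho> where "\<rho> = min (e / 2) (v 2 / 2)"
  have \<rho>: "0 < \<rho>" "\<rho> \<le> v 2 / 2" "\<rho> < e" using c e by (auto simp: \<rho>_def)
  show ?thesis
  proof (intro exI[of _ "v 2 * \<rho>"] conjI ballI impI)
    show "0 < v 2 * \<rho>" using c \<rho> by simp
    fix h assume "h \<in> carrier (Qp p)" and lt: "Qp_norm h < v 2 * \<rho>"
    then obtain S where S: "S \<in> padic_Cauchy p" "h = padic_class S" by (auto simp: carrier_Qp)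
    obtain M where M: "\<And>n. n \<ge> M \<Longrightarrow> v (S n) < v 2 * \<rho>"
      using order_tendstoD(2)[OF Qp_norm_class[OF S(1)]] lt S(2) by (auto simp: eventually_sequentially)
    \<comment> \<open>A diagonal choice: n iteration steps for the n-th term of S, so that the
      residual at n is at most |2| \<rho> / 2^n and tends to 0.\<close>
    define T where "T n = sqrt_iter (S n) n" for n
    have T: "v (T n) \<le> \<rho>" "v ((1 + T n) * (1 + T n) - (1 + S n)) \<le> v 2 * \<rho> / 2 ^ n"
      if "n \<ge> M" for n
      using sqrt_iter_bounds[OF \<rho>(1,2)] M[OF that] unfolding T_def by (simp_all add: less_imp_le)
    have lim: "(\<lambda>n. v 2 * \<rho> / 2 ^ n) \<longlonglongrightarrow> 0"
      using tendsto_mult_right_zero[OF LIMSEQ_inverse_realpow_zero[of 2], of "v 2 * \<rho>"]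
      by (simp add: divide_inverse)
    have TS: "(\<lambda>n. (1 + T n) * (1 + T n) - (1 + S n)) \<in> padic_null p"
      unfolding padic_null_def mem_Collect_eq
      by (rule tendsto_0_le[OF lim, of _ 1])
        (use T c \<rho>(1) in \<open>auto simp: p eventually_sequentially intro!: exI[of _ M]\<close>)
    have TC: "T \<in> padic_Cauchy p"
    proof (rule padic_CauchyI[OF p])
      fix d :: real assume d: "0 < d"
      have "0 < v 2 * d" using c d by simp
      then obtain N1 where N1: "\<And>m n. m \<ge> N1 \<Longrightarrow> n \<ge> N1 \<Longrightarrow> v (S m - S n) < v 2 * d"
        using padic_CauchyD[OF p S(1)] by blast
      obtain N2 where N2: "\<And>n. n \<ge> N2 \<Longrightarrow> v ((1 + T n) * (1 + T n) - (1 + S n)) < v 2 * d"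
        using padic_nullD[OF p TS \<open>0 < v 2 * d\<close>] by blast
      have "v (T m - T n) < d" if m: "m \<ge> max M (max N1 N2)" and n: "n \<ge> max M (max N1 N2)" for m n
      proof -
        \<comment> \<open>Since T m + T n is smaller than 2, the factor 2 + T m + T n has absolute
          value at least |2|. The difference of the squares of 1 + T m and 1 + T n therefore
          controls T m - T n.\<close>
        have "v (T m + T n) < v 2"
          using padic_abs_add[OF p, of "T m" "T n"] T(1)[of m] T(1)[of n] m n \<rho> c by simp
        then have "v 2 \<le> v (2 + (T m + T n))"
          using padic_abs_diff[OF p, of "2 + (T m + T n)" "T m + T n"] by simp
        then have "v (T m - T n) * v 2 \<le> v ((T m - T n) * (2 + (T m + T n)))"
          unfolding padic_abs_mult[OF p] using padic_abs_nonneg[OF p] by (intro mult_left_mono)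
        also have "(T m - T n) * (2 + (T m + T n)) = ((1 + T m) * (1 + T m) - (1 + S m))
            - ((1 + T n) * (1 + T n) - (1 + S n)) + (S m - S n)"
          by (simp add: algebra_simps)
        also have "v \<dots> < v 2 * d"
          using padic_abs_add[OF p, of "((1 + T m) * (1 + T m) - (1 + S m))
            - ((1 + T n) * (1 + T n) - (1 + S n))" "S m - S n"]
            padic_abs_diff[OF p, of "(1 + T m) * (1 + T m) - (1 + S m)" "(1 + T n) * (1 + T n) - (1 + S n)"]
            N1[of m n] N2[of m] N2[of n] m n by simp
        finally show ?thesis using c by simp
      qed
      then show "\<exists>N. \<forall>m\<ge>N. \<forall>n\<ge>N. v (T m - T n) < d" by blast
    qed
    have "Qp_norm (padic_class T) \<le> \<rho>"
      using LIMSEQ_le_const2[OF Qp_norm_class[OF TC]] T(1) by blast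
    moreover have C1: "(\<lambda>n. 1 + T n) \<in> padic_Cauchy p" "(\<lambda>n. 1 + S n) \<in> padic_Cauchy p"
      using padic_Cauchy_add[OF p padic_Cauchy_const[OF p]] TC S(1) by blast+
    moreover have "padic_class (\<lambda>n. (1 + T n) * (1 + T n)) = padic_class (\<lambda>n. 1 + S n)"
      using padic_class_eqI[OF padic_Cauchy_mult[OF p C1(1) C1(1)] C1(2) TS] .
    ultimately show "\<exists>r\<in>carrier (Qp p). Qp_norm r < e \<and>
        (\<one>\<^bsub>Qp p\<^esub> \<oplus>\<^bsub>Qp p\<^esub> r) \<otimes>\<^bsub>Qp p\<^esub> (\<one>\<^bsub>Qp p\<^esub> \<oplus>\<^bsub>Qp p\<^esub> r) = \<one>\<^bsub>Qp p\<^esub> \<oplus>\<^bsub>Qp p\<^esub> h"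
      using TC S \<rho>(3) padic_class_closed[OF TC]
      by (intro bexI[of _ "padic_class T"]) (simp_all add: padic_class_add padic_class_mult padic_Cauchy_const[OF p] flip: padic_class_one)
  qed
qed

section \<open>The p-adic and the real instance\<close>

text \<open>Constant sequences embed the rationals with their absolute value: 2 stays nonzero and
  powers of p are arbitrarily small. The laws for \<open>Qp_norm\<close> follow by taking limits
  along representatives.\<close>

lemma abs_field_Qp: "abs_field (Qp p) Qp_norm"
proof (intro abs_field.intro field_Qp[OF p] abs_field_axioms.intro)
  have const: "Qp_norm (padic_class (\<lambda>_. q)) = v q" for q
    using LIMSEQ_unique[OF Qp_norm_class[OF padic_Cauchy_const[OF p]] tendsto_const] .
  have const_nonzero: "padic_class (\<lambda>_. q) \<noteq> \<zero>\<^bsub>Qp p\<^esub>" if "q \<noteq> 0" for q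
    using that by (intro padic_class_nonzero) (auto simp: padic_null_def LIMSEQ_const_iff p)
  show "Qp_norm \<one>\<^bsub>Qp p\<^esub> = 1"
    using const[of 1] by (simp add: padic_class_one p)
  show "\<one>\<^bsub>Qp p\<^esub> \<oplus>\<^bsub>Qp p\<^esub> \<one>\<^bsub>Qp p\<^esub> \<noteq> \<zero>\<^bsub>Qp p\<^esub>"
    using const_nonzero[of 2] by (simp add: padic_class_add p flip: padic_class_one)
  show "0 \<le> Qp_norm x" if "x \<in> carrier (Qp p)" for x
    using that LIMSEQ_le_const[OF Qp_norm_class] by (auto simp: carrier_Qp p)
  show "Qp_norm (\<ominus>\<^bsub>Qp p\<^esub> x) = Qp_norm x" if x: "x \<in> carrier (Qp p)" for x
  proof -
    obtain S where S: "S \<in> padic_Cauchy p" "x = padic_class S"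
      using x by (auto simp: carrier_Qp)
    show ?thesis
      using LIMSEQ_unique[OF Qp_norm_class[OF padic_Cauchy_uminus[OF p S(1)]]] Qp_norm_class[OF S(1)] S
      by (simp add: padic_class_uminus p)
  qed
  show "Qp_norm (x \<otimes>\<^bsub>Qp p\<^esub> y) = Qp_norm x * Qp_norm y"
    and "Qp_norm (x \<oplus>\<^bsub>Qp p\<^esub> y) \<le> Qp_norm x + Qp_norm y"
    if xy: "x \<in> carrier (Qp p)" "y \<in> carrier (Qp p)" for x y
  proof -
    obtain S T where S: "S \<in> padic_Cauchy p" "x = padic_class S"
      and T: "T \<in> padic_Cauchy p" "y = padic_class T"
      using xy by (auto simp: carrier_Qp)
    note lim = Qp_norm_class[OF S(1)] Qp_norm_class[OF T(1)]
    show "Qp_norm (x \<otimes>\<^bsub>Qp p\<^esub> y) = Qp_norm x * Qp_norm y"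
      using LIMSEQ_unique[OF Qp_norm_class[OF padic_Cauchy_mult[OF p S(1) T(1)]]] tendsto_mult[OF lim] S T
      by (simp add: padic_class_mult padic_abs_mult[OF p])
    have "v (S n + T n) \<le> v (S n) + v (T n)" for n
      using padic_abs_add[OF p, of "S n" "T n"] padic_abs_nonneg[OF p, of "S n"]
        padic_abs_nonneg[OF p, of "T n"] by linarith
    then show "Qp_norm (x \<oplus>\<^bsub>Qp p\<^esub> y) \<le> Qp_norm x + Qp_norm y"
      using LIMSEQ_le[OF Qp_norm_class[OF padic_Cauchy_add[OF p S(1) T(1)]] tendsto_add[OF lim]] S T
      by (auto simp: padic_class_add)
  qed
  show "\<exists>x\<in>carrier (Qp p). x \<noteq> \<zero>\<^bsub>Qp p\<^esub> \<and> Qp_norm x < e" if "0 < e" for e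
  proof -
    have "1 / real p < 1" using prime_gt_1_nat[OF p] by simp
    then obtain k where "(1 / real p) ^ k < e"
      using real_arch_pow_inv[OF \<open>0 < e\<close>] by blast
    then have "Qp_norm (padic_class (\<lambda>_. of_nat p ^ k)) < e"
      by (simp only: const padic_abs_power padic_abs_p)
    then show ?thesis
      using const_nonzero[of "of_nat p ^ k"] padic_class_closed[OF padic_Cauchy_const[OF p]]
        prime_gt_0_nat[OF p]
      by (intro bexI[of _ "padic_class (\<lambda>_. of_nat p ^ k)"]) auto
  qed
qed (rule Qp_sqrt)

end

lemma abs_field_real: "abs_field real_field (abs :: real \<Rightarrow> real)"
proof (intro abs_field.intro field_from_type_algebra abs_field_axioms.intro)
  show "\<exists>d>0. \<forall>h\<in>carrier real_field. \<bar>h\<bar> < d \<longrightarrow> (\<exists>r\<in>carrier real_field. \<bar>r\<bar> < e \<and>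
      (\<one>\<^bsub>real_field\<^esub> \<oplus>\<^bsub>real_field\<^esub> r) \<otimes>\<^bsub>real_field\<^esub> (\<one>\<^bsub>real_field\<^esub> \<oplus>\<^bsub>real_field\<^esub> r)
        = \<one>\<^bsub>real_field\<^esub> \<oplus>\<^bsub>real_field\<^esub> h)" if "0 < e" for e :: real
  proof -
    have "\<exists>r. \<bar>r\<bar> < e \<and> (1 + r) * (1 + r) = 1 + h" if h: "\<bar>h\<bar> < min 1 e" for h :: real
    proof (intro exI[of _ "sqrt (1 + h) - 1"] conjI)
      let ?s = "sqrt (1 + h)"
      have s: "0 \<le> ?s" "?s * ?s = 1 + h" using h by auto
      \<comment> \<open>As s + 1 is at least 1, this factorisation gives |s - 1| \<le> |h|.\<close>
      then have "(?s - 1) * (?s + 1) = h" by (simp add: algebra_simps)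
      then have "\<bar>?s - 1\<bar> * \<bar>?s + 1\<bar> = \<bar>h\<bar>" by (metis abs_mult)
      moreover have "\<bar>?s - 1\<bar> * 1 \<le> \<bar>?s - 1\<bar> * \<bar>?s + 1\<bar>" using s(1) by (intro mult_left_mono) auto
      ultimately show "\<bar>?s - 1\<bar> < e" using h by simp
      show "(1 + (?s - 1)) * (1 + (?s - 1)) = 1 + h" using s(2) by simp
    qed
    with \<open>0 < e\<close> show ?thesis
      by (intro exI[of _ "min 1 e"]) (auto simp: ring_of_type_algebra_def)
  qed
  show "\<exists>x\<in>carrier real_field. x \<noteq> \<zero>\<^bsub>real_field\<^esub> \<and> \<bar>x\<bar> < e" if "0 < e" for e :: real
    using that by (intro bexI[of _ "e / 2"]) (auto simp: ring_of_type_algebra_def)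
  show "\<bar>\<ominus>\<^bsub>real_field\<^esub> x\<bar> = \<bar>x\<bar>" if "x \<in> carrier real_field" for x :: real
  proof -
    interpret field "real_field" by (rule field_from_type_algebra)
    have "\<ominus>\<^bsub>real_field\<^esub> x = - x"
      by (rule minus_equality) (simp_all add: ring_of_type_algebra_def)
    then show ?thesis by simp
  qed
qed (auto simp: ring_of_type_algebra_def abs_mult)

theorem proposition6p1:
  fixes n :: nat
  assumes "n \<ge> 1"
  shows "(\<forall>p::nat. Factorial_Ring.prime p \<longrightarrow>
            (\<exists>a\<in>proj_plane (Qp p). \<exists>b\<in>proj_plane (Qp p).
               (f_map (Qp p) ^^ n) a = (f_map (Qp p) ^^ n) b \<and>
               (f_map (Qp p) ^^ (n - 1)) a \<noteq> (f_map (Qp p) ^^ (n - 1)) b)) \<and>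
         (\<exists>a\<in>proj_plane real_field. \<exists>b\<in>proj_plane real_field.
            (f_map real_field ^^ n) a = (f_map real_field ^^ n) b \<and>
            (f_map real_field ^^ (n - 1)) a \<noteq> (f_map real_field ^^ (n - 1)) b)"
  by (intro conjI allI impI abs_field.f_map_collision[OF abs_field_Qp]
      abs_field.f_map_collision[OF abs_field_real] assms)

end
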